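(* Let $(X,\|\cdot\|)$ and $(V,\|\cdot\|_V)$ be real Banach spaces, $S\subseteq X$, with a symmetrization map $*$ and a polarization map indexed by $\mathcal H_*$ forming an abstract symmetrization framework (defined in the context). Let $m\ge 1$, let $\mathbb D$ and $\mathbb S$ be the closed unit ball and the unit sphere of $\mathbb R^m$. Let $\sigma>0$, let $\Lambda\subset\mathbb R$ be a compact interval with $[1-\sigma,1]\subseteq\Lambda$, and let $f:\Lambda\times X\to\mathbb R$ be such that $f(\lambda;\cdot)$ is continuous for every $\lambda\in\Lambda$. Let $\Gamma_0\subset C(\mathbb S;X)$ and $$\Gamma:=\{\gamma\in C(\mathbb D,X):\gamma|_{\mathbb S}\in\Gamma_0\}\neq\emptyset,\quad c(\lambda):=\inf_{\gamma\in\Gamma}\sup_{t\in\mathbb D}f(\lambda;\gamma(t)),\quad a(\lambda):=\sup_{\gamma_0\in\Gamma_0}\sup_{\tau\in\mathbb S}f(\lambda;\gamma_0(\tau)).$$ Assume: (i) $c(\lambda)>a(\lambda)$ for all $\lambda\in\Lambda$. (ii) For every sequence $(\lambda_h,u_h)\subset\Lambda\times X$ with $(\lambda_h)$ strictly increasing and converging to $\lambda$, for which there exists $C\in\mathbb R$ with $$f(\lambda_h;u_h)\le C,\qquad -f(\lambda;u_h)\le C,\qquad \frac{f(\lambda_h;u_h)-f(\lambda;u_h)}{\lambda-\lambda_h}\le C\qquad\text{for all }h\ge1,$$ one has $\|u_h\|\le\mathcal M$ for some number $\mathcal M=\mathcal M(C)\ge0$ and all $h\ge1$, and, for every $\varepsilon>0$,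 $f(\lambda;u_h)\le f(\lambda_h;u_h)+\varepsilon$ for all $h\ge1$ sufficiently large. (iii) For every $\gamma\in\Gamma$ there are $\hat\gamma\in\Gamma$ and $H_0\in\mathcal H_*$ such that $\hat\gamma(\mathbb D)\subset S$, the map $\tau\mapsto\hat\gamma(\tau)^{H_0}$ on $\mathbb S$ belongs to $\Gamma_0$, and $f(\lambda;\hat\gamma(t))\le f(\lambda;\gamma(t))$ for all $t\in\mathbb D$ and $\lambda\in\Lambda$. Moreover, $f(\lambda;u^H)\le f(\lambda;u)$ for all $\lambda\in\Lambda$, $H\in\mathcal H_*$ and $u\in S$. (iv) $f(\lambda;\cdot)$ satisfies the condition $(SBPS)_{c(\lambda)}$ for all $\lambda\in[1-\sigma,1]$. Then there exists a sequence $(\lambda_j,u_j)\subset[1-\sigma,1]\times X$ such that $(\lambda_j)$ is strictly increasing and converges to $1$ and, for all $j\ge1$, $$f(\lambda_j;u_j)=c(\lambda_j),\qquad |df(\lambda_j;\cdot)|(u_j)=0,\qquad u_j=u_j^*.$$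
   Context: Abstract symmetrization framework: $X,V$ are Banach spaces, $S\subseteq X$, $\mathcal H_*$ is a path-connected topological space, and two maps are given: $*:S\to S$, $u\mapsto u^*$ (symmetrization), and $h:S\times\mathcal H_*\to S$, $(u,H)\mapsto u^H$ (polarization), such that: (1) $X$ is continuously embedded in $V$; (2) $h$ is continuous ($S$ with the topology induced by $X$); (3) for all $u\in S$, $H\in\mathcal H_*$: $(u^* )^H=(u^H)^*=u^*$ and $u^{HH}=u^H$; (4) there is a sequence $(H_m)\subset\mathcal H_*$ such that, for every $u\in S$, $u^{H_1\cdots H_m}:=(\cdots(u^{H_1})^{H_2}\cdots)^{H_m}$ converges to $u^*$ in $V$ as $m\to\infty$; (5) $\|u^H-v^H\|_V\le\|u-v\|_V$ for all $u,v\in S$, $H\in\mathcal H_*$. Moreover there is given a Lipschitz map $\Theta:(X,\|\cdot\|_V)\to(S,\|\cdot\|_V)$ with $\Theta|_S=\mathrm{Id}|_S$, and $*$ is extended to all of $X$ by $u^*:=(\Theta(u))^*$ for $u\in X$. (Consequently there is $C_\Theta>0$ with $\|u^*-v^*\|_V\le C_\Theta\|u-v\|_V$ for all $u,v\in X$.) Weak slope: for a metric space $(X,d)$, a continuous $g:X\to\mathbb R$ and $u\in X$, $|dg|(u)\in[0,+\infty]$ is the supremum of the $\sigma\in[0,\infty)$ such that there exist $\delta>0$ and a continuous map $\mathcal H:B(u,\delta)\times[0,\delta]\to X$ ($B(u,\delta)$ the open ball) with $d(\mathcal H(v,t),v)\le t$ and $g(\mathcal H(v,t))\le g(v)-\sigma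 t$ for all $v\in B(u,\delta)$, $t\in[0,\delta]$. $(SBPS)_c$-sequence (symmetric bounded Palais-Smale sequence at level $c\in\mathbb R$) for a continuous $g:X\to\mathbb R$: a sequence $(u_n)\subset X$ that is bounded in $X$ and satisfies $|dg|(u_n)\to0$, $g(u_n)\to c$ and $\|u_n-u_n^*\|_V\to0$. The functional $g$ satisfies the condition $(SBPS)_c$ if every $(SBPS)_c$-sequence for $g$ admits a subsequence converging in $X$. *)

theory Defs
  imports "HOL-Analysis.Analysis"
begin

text \<open>
  \<open>iter_pol pol u Hs m\<close> is $u^{H_1 \cdots H_m}$ where $H_{i+1}$ is \<open>Hs i\<close>.
\<close>
primrec iter_pol :: "('x \<Rightarrow> 'h \<Rightarrow> 'x) \<Rightarrow> 'x \<Rightarrow> (nat \<Rightarrow> 'h) \<Rightarrow> nat \<Rightarrow> 'x" where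
  "iter_pol pol u Hs 0 = u"
| "iter_pol pol u Hs (Suc m) = pol (iter_pol pol u Hs m) (Hs m)"

text \<open>
  The spaces \<open>X\<close> and \<open>V\<close> are the types \<open>'x\<close> and \<open>'v\<close>, and \<open>emb\<close> is the continuous embedding
  of \<open>X\<close> into \<open>V\<close>, so that $\|u\|_V$ is \<open>norm (emb u)\<close> for \<open>u\<close> in \<open>X\<close>. The space
  $\mathcal{H}_*$ is the set \<open>HH\<close> with the subspace topology. The maps \<open>star\<close> and \<open>pol\<close> are
  meaningful only on \<open>S\<close> and on \<open>S \<times> HH\<close>.
\<close>
locale symmetrization_framework =
  fixes emb :: "'x::banach \<Rightarrow> 'v::banach"
    and S :: "'x set"
    and HH :: "'h::topological_space set"
    and star :: "'x \<Rightarrow> 'x"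
    and pol :: "'x \<Rightarrow> 'h \<Rightarrow> 'x"
    and \<Theta> :: "'x \<Rightarrow> 'x"
  assumes path_connected_HH: "path_connected HH"
    and star_in: "\<And>u. u \<in> S \<Longrightarrow> star u \<in> S"
    and pol_in: "\<And>u H. u \<in> S \<Longrightarrow> H \<in> HH \<Longrightarrow> pol u H \<in> S"
    and emb_bounded_linear: "bounded_linear emb"
    and emb_inj: "inj emb"
    and pol_continuous: "continuous_on (S \<times> HH) (\<lambda>(u, H). pol u H)"
    and pol_star: "\<And>u H. u \<in> S \<Longrightarrow> H \<in> HH \<Longrightarrow> pol (star u) H = star u"
    and star_pol: "\<And>u H. u \<in> S \<Longrightarrow> H \<in> HH \<Longrightarrow> star (pol u H) = star u"
    and pol_pol: "\<And>u H. u \<in> S \<Longrightarrow> H \<in> HH \<Longrightarrow> pol (pol u H) H = pol u H"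
    and pol_approx:
      "\<exists>Hs. range Hs \<subseteq> HH \<and> (\<forall>u\<in>S. (\<lambda>m. emb (iter_pol pol u Hs m)) \<longlonglongrightarrow> emb (star u))"
    and pol_contraction: "\<And>u v H. u \<in> S \<Longrightarrow> v \<in> S \<Longrightarrow> H \<in> HH \<Longrightarrow>
      norm (emb (pol u H) - emb (pol v H)) \<le> norm (emb u - emb v)"
    and Theta_in: "\<And>u. \<Theta> u \<in> S"
    and Theta_id: "\<And>u. u \<in> S \<Longrightarrow> \<Theta> u = u"
    and Theta_lipschitz: "\<exists>L. \<forall>u v. norm (emb (\<Theta> u) - emb (\<Theta> v)) \<le> L * norm (emb u - emb v)"

definition ext_star :: "('x \<Rightarrow> 'x) \<Rightarrow> ('x \<Rightarrow> 'x) \<Rightarrow> 'x \<Rightarrow> 'x" where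
  "ext_star star \<Theta> u = star (\<Theta> u)"

definition weak_slope :: "('a::metric_space \<Rightarrow> real) \<Rightarrow> 'a \<Rightarrow> ennreal" where
  "weak_slope g u = Sup {ennreal \<sigma> | \<sigma>. \<sigma> \<ge> 0 \<and>
     (\<exists>\<delta>>0. \<exists>\<H>. continuous_on (ball u \<delta> \<times> {0..\<delta>}) (\<lambda>(v, t). \<H> v t) \<and>
        (\<forall>v\<in>ball u \<delta>. \<forall>t\<in>{0..\<delta>}. dist (\<H> v t) v \<le> t \<and> g (\<H> v t) \<le> g v - \<sigma> * t))}"

text \<open>
  In the following two definitions \<open>xstar\<close> is the symmetrization extended to all of \<open>X\<close>,
  that is, \<open>ext_star star \<Theta>\<close>.
\<close>
definition SBPS_seq ::
  "('x::real_normed_vector \<Rightarrow> 'v::real_normed_vector) \<Rightarrow> ('x \<Rightarrow> 'x) \<Rightarrow>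
    ('x \<Rightarrow> real) \<Rightarrow> real \<Rightarrow> (nat \<Rightarrow> 'x) \<Rightarrow> bool" where
  "SBPS_seq emb xstar g c u \<longleftrightarrow>
     bounded (range u) \<and>
     (\<lambda>n. weak_slope g (u n)) \<longlonglongrightarrow> 0 \<and>
     (\<lambda>n. g (u n)) \<longlonglongrightarrow> c \<and>
     (\<lambda>n. norm (emb (u n) - emb (xstar (u n)))) \<longlonglongrightarrow> 0"

definition SBPS_condition ::
  "('x::real_normed_vector \<Rightarrow> 'v::real_normed_vector) \<Rightarrow> ('x \<Rightarrow> 'x) \<Rightarrow>
    ('x \<Rightarrow> real) \<Rightarrow> real \<Rightarrow> bool" where
  "SBPS_condition emb xstar g c \<longleftrightarrow>
     (\<forall>u. SBPS_seq emb xstar g c u \<longrightarrow> (\<exists>r. strict_mono r \<and> convergent (u \<circ> r)))"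

text \<open>
  Maps defined on a subset \<open>A\<close> of a type are represented by the functions that are
  \<open>undefined\<close> outside \<open>A\<close>; \<open>cont_maps A\<close> is $C(A; X)$.
\<close>
definition cont_maps :: "'a::topological_space set \<Rightarrow> ('a \<Rightarrow> 'b::topological_space) set" where
  "cont_maps A = {\<gamma> \<in> extensional A. continuous_on A \<gamma>}"

definition minimax_class ::
  "('e::real_normed_vector \<Rightarrow> 'x::topological_space) set \<Rightarrow> ('e \<Rightarrow> 'x) set" where
  "minimax_class \<Gamma>0 = {\<gamma> \<in> cont_maps (cball 0 1). restrict \<gamma> (sphere 0 1) \<in> \<Gamma>0}"

text \<open>
  The levels $c(\lambda)$ and $a(\lambda)$ are extended real numbers, since the real-valued
  \<open>SUP\<close> and \<open>INF\<close> are unspecified for unbounded families.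
\<close>
definition minimax_level ::
  "('e::real_normed_vector \<Rightarrow> 'x::topological_space) set \<Rightarrow> ('x \<Rightarrow> real) \<Rightarrow> ereal" where
  "minimax_level \<Gamma>0 g = (INF \<gamma>\<in>minimax_class \<Gamma>0. SUP t\<in>cball 0 1. ereal (g (\<gamma> t)))"

definition boundary_level ::
  "('e::real_normed_vector \<Rightarrow> 'x::topological_space) set \<Rightarrow> ('x \<Rightarrow> real) \<Rightarrow> ereal" where
  "boundary_level \<Gamma>0 g = (SUP \<gamma>\<in>\<Gamma>0. SUP \<tau>\<in>sphere 0 1. ereal (g (\<gamma> \<tau>)))"

end

theory Submission
  imports Defs
begin

text \<open>
  The levels \<open>c\<close> form an arbitrary real function of the parameter, and such a function cannot have
  left derivative $-\infty$ on a whole interval (Baire category makes it monotone on a subinterval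
  first). So parameters \<open>\<mu>\<close> with
  $(c(\lambda_h) - c(\mu)) / (\mu - \lambda_h)$ bounded along some $\lambda_h \uparrow \mu$ accumulate at 1.
  At such a \<open>\<mu>\<close>, curves almost optimal for $\lambda_h$ are almost optimal for \<open>\<mu>\<close>, and by (ii)
  their high points stay in a fixed ball. Polarizing a curve does not raise it and makes its high
  points almost symmetric, since near the sphere the curve is low. Ekeland's principle on the space
  of curves, combined with a deformation glued from the local deformations that witness the weak slope,
  then gives an almost critical point close to a high point of the curve, and (SBPS) applies.
\<close>

section \<open>Left difference quotients of arbitrary real functions\<close>

text \<open>The obstacle is that \<open>f\<close> need not be monotone in the parameter, so nothing
  makes the level differentiable almost everywhere; what can be had is a one-sided bound on left
  difference quotients at some points, and this is what (ii) consumes. Put d = \<mu> - \<lambda>_h.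
  If a curve stays below c(\<lambda>_h) + d for the parameter \<lambda>_h, then at its points where
  f(\<mu>; .) is at least c(\<mu>) - d the quotient in (ii) is at most C0 + 2, where C0 bounds the
  quotient of the levels. Both slacks must therefore be of order d.

  Minimizing over curves does not preserve symmetry and leaves S. Hence symmetry and boundedness are
  required only of the high points of the initial curve. They pass to the almost critical point
  because it is within distance k of such a point and the extended symmetrization is Lipschitz for
  the norm of V.\<close>

lemma exists_strict_mono_to_left:
  fixes x :: real
  assumes "\<And>d. d < x \<Longrightarrow> \<exists>y. d < y \<and> y < x \<and> P y"
  shows "\<exists>s :: nat \<Rightarrow> real. strict_mono s \<and> s \<longlonglongrightarrow> x \<and> (\<forall>n. s n < x \<and> P (s n))"
proof -
  have "\<exists>s. \<forall>n. (s n < x \<and> x - 1 / real (Suc n) < s n \<and> P (s n)) \<and> s n < s (Suc n)"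
  proof (rule dependent_nat_choice)
    show "\<exists>y. y < x \<and> x - 1 / real (Suc 0) < y \<and> P y"
      using assms[of "x - 1"] by auto
  next
    fix y n
    assume "y < x \<and> x - 1 / real (Suc n) < y \<and> P y"
    then show "\<exists>z. (z < x \<and> x - 1 / real (Suc (Suc n)) < z \<and> P z) \<and> y < z"
      using assms[of "max y (x - 1 / real (Suc (Suc n)))"] by auto
  qed
  then obtain s :: "nat \<Rightarrow> real" where s: "\<And>n. s n < x" "\<And>n. x - 1 / real (Suc n) < s n"
      "\<And>n. P (s n)" "\<And>n. s n < s (Suc n)"
    by blast
  have "s \<longlonglongrightarrow> x"
  proof (rule tendsto_sandwich)
    show "(\<lambda>n. x - 1 / real (Suc n)) \<longlonglongrightarrow> x"
      using tendsto_diff[OF tendsto_const LIMSEQ_inverse_real_of_nat, of x]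
      by (simp add: inverse_eq_divide)
    show "\<forall>\<^sub>F n in sequentially. x - 1 / real (Suc n) \<le> s n"
      by (intro always_eventually allI less_imp_le s(2))
    show "\<forall>\<^sub>F n in sequentially. s n \<le> x"
      by (intro always_eventually allI less_imp_le s(1))
  qed simp
  with s show ?thesis
    by (auto simp: strict_mono_Suc_iff)
qed

text \<open>Otherwise the left derivative is -\<infinity> at every point. With C = 0 this makes
  \<open>c\<close> nonincreasing on some subinterval. A nonincreasing function has a finite secant
  slope there, and a continuation argument from right to left contradicts it.\<close>

lemma exists_non_steep_point:
  fixes c :: "real \<Rightarrow> real"
  assumes "\<alpha> < \<beta>"
  shows "\<exists>x\<in>{\<alpha><..<\<beta>}. \<exists>C. \<forall>d<x. \<exists>s. d < s \<and> s < x \<and> c s - c x \<le> C * (x - s)"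
proof (rule ccontr)
  assume "\<not> ?thesis"
  then have steep: "\<exists>d<x. \<forall>s. d < s \<and> s < x \<longrightarrow> c s - c x > C * (x - s)"
    if "\<alpha> < x" "x < \<beta>" for x C
    using that by (force simp: not_le)
  \<comment> \<open>Steepness with C = 0 puts every point into some \<open>E n\<close>; the index
    makes the length of the left neighbourhood uniform.\<close>
  define E where "E n = {x \<in> {\<alpha><..<\<beta>}. \<forall>s. x - 1 / real (Suc n) < s \<and> s < x \<longrightarrow> c s \<ge> c x}" for n
  have cover: "{\<alpha><..<\<beta>} \<subseteq> (\<Union>n. closure (E n))"
  proof
    fix x assume x: "x \<in> {\<alpha><..<\<beta>}"
    then obtain d where d: "d < x" "\<And>s. d < s \<and> s < x \<Longrightarrow> c s - c x > 0 * (x - s)"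
      using steep[of x 0] by auto
    obtain n where "1 / real (Suc n) < x - d"
      using d(1) by (metis diff_gt_0_iff_gt inverse_eq_divide reals_Archimedean)
    moreover have "c x \<le> c s" if "d < s" "s < x" for s
      using d(2)[of s] that by simp
    ultimately have "x \<in> E n"
      using x by (auto simp: E_def)
    then show "x \<in> (\<Union>n. closure (E n))"
      using closure_subset by blast
  qed
  have "\<exists>n. interior (closure (E n)) \<noteq> {}"
  proof (rule ccontr)
    assume "\<not> ?thesis"
    then have "euclidean interior_of (\<Union>(range (\<lambda>n. closure (E n)))) = {}"
      by (intro Baire_category_alt)
        (auto simp: completely_metrizable_space_euclidean)
    then have "interior (\<Union>n. closure (E n)) = {}"
      by simp
    moreover have "{\<alpha><..<\<beta>} \<subseteq> interior (\<Union>n. closure (E n))"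
      by (intro interior_maximal cover) simp
    ultimately show False
      using assms by (metis Diff_eq_empty_iff empty_subsetI greaterThanLessThan_empty_iff not_less subset_antisym)
  qed
  then obtain n where n: "interior (closure (E n)) \<noteq> {}" ..
  let ?I = "interior (closure (E n))"
  have "?I \<inter> E n \<noteq> {}"
    using n interior_subset[of "closure (E n)"] open_Int_closure_eq_empty[of ?I "E n"] by auto
  then obtain z where z: "z \<in> ?I" "z \<in> E n" by blast
  then have "\<alpha> < z" "z < \<beta>" by (auto simp: E_def)
  have "open (?I \<inter> {\<alpha><..<\<beta>})" by auto
  then obtain e where e: "e > 0" "ball z e \<subseteq> ?I \<inter> {\<alpha><..<\<beta>}"
    using z \<open>\<alpha> < z\<close> \<open>z < \<beta>\<close> by (metis IntI greaterThanLessThan_iff openE)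
  define \<omega> where "\<omega> = 1 / real (Suc n)"
  have "\<omega> / 2 > 0" by (simp add: \<omega>_def)
  then obtain r where r: "r > 0" "r < e" "r < \<omega> / 2"
    using field_lbound_gt_zero[OF e(1)] by blast
  \<comment> \<open>The interval is shorter than \<open>\<omega>\<close>, so the property that
    defines \<open>E n\<close> reaches across all of \<open>{p..q}\<close>.\<close>
  define p q where "p = z - r" and "q = z + r"
  have pq: "p < q" "q - p < \<omega>"
    using r(1,3) unfolding p_def q_def by linarith+
  have sub: "{p..q} \<subseteq> closure (E n)" "{p..q} \<subseteq> {\<alpha><..<\<beta>}"
  proof -
    have "{p..q} \<subseteq> ball z e"
      using r by (auto simp: p_def q_def dist_real_def)
    then show "{p..q} \<subseteq> closure (E n)" "{p..q} \<subseteq> {\<alpha><..<\<beta>}"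
      using e(2) interior_subset by blast+
  qed
  \<comment> \<open>Density gives a point t' of \<open>E n\<close> between max d s and t. Steepness
    at t yields c t \<le> c t', and membership of t' in \<open>E n\<close> yields c t' \<le> c
    s.\<close>
  have anti: "c t \<le> c s" if "p \<le> s" "s < t" "t \<le> q" for s t
  proof -
    have tb: "\<alpha> < t" "t < \<beta>"
      using subsetD[OF sub(2), of t] that by simp_all
    obtain d where d: "d < t" "\<And>s. d < s \<and> s < t \<Longrightarrow> c s - c t > 0 * (t - s)"
      using steep[of t 0] tb by blast
    define w where "w = (max d s + t) / 2"
    have w: "d < w" "s < w" "w < t" using that d(1) by (auto simp: w_def max_def)
    then have "w \<in> closure (E n)"
      using sub(1) that by (auto simp: subset_iff)
    then have "{max d s<..<t} \<inter> E n \<noteq> {}"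
      using open_Int_closure_eq_empty[of "{max d s<..<t}" "E n"] w by fastforce
    then obtain t' where t': "d < t'" "s < t'" "t' < t" "t' \<in> E n"
      by auto
    have "c t \<le> c t'" using d(2)[of t'] t' by auto
    also have "\<dots> \<le> c s"
    proof -
      have "\<forall>s. t' - \<omega> < s \<and> s < t' \<longrightarrow> c t' \<le> c s"
        using t'(4) by (simp add: E_def \<omega>_def)
      moreover have "t' - \<omega> < s" using t' that pq by linarith
      ultimately show ?thesis using t' by blast
    qed
    finally show ?thesis .
  qed
  \<comment> \<open>The extra 1 makes c p + K p = c q + K q - 1, so p does not belong to the set
    \<open>T\<close> below. The contradiction is that the infimum of \<open>T\<close> belongs to
    \<open>T\<close> and equals p.\<close>
  define K where "K = (c p - c q + 1) / (q - p)"
  have K: "K > 0" "K * (q - p) = c p - c q + 1"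
    using anti[of p q] pq by (auto simp: K_def)
  define T where "T = {s \<in> {p..q}. c s + K * s \<ge> c q + K * q}"
  have "q \<in> T" and Tb: "bdd_below T"
    using pq by (auto simp: T_def)
  define t where "t = Inf T"
  have t: "p \<le> t" "t \<le> q"
    using \<open>q \<in> T\<close> Tb by (auto simp: t_def T_def intro!: cInf_lower cInf_greatest)
  \<comment> \<open>Moving left, a nonincreasing function can only go up, so points of
    \<open>T\<close> close to the infimum on its right leave no room for a deficit;
    \<open>\<eta>\<close> is the deficit divided by K.\<close>
  have "t \<in> T"
  proof (rule ccontr)
    assume "t \<notin> T"
    then have lt: "c t + K * t < c q + K * q" using t by (auto simp: T_def)
    define \<eta> where "\<eta> = (c q + K * q - (c t + K * t)) / K"
    have "\<eta> > 0" using lt K by (simp add: \<eta>_def)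
    then obtain s where s: "s \<in> T" "s < t + \<eta>"
      using cInf_lessD[of T "t + \<eta>"] \<open>q \<in> T\<close> by (auto simp: t_def)
    have "t < s" using cInf_lower[OF s(1) Tb] s(1) \<open>t \<notin> T\<close> by (metis t_def order_le_less)
    have "c s \<le> c t" using anti[of t s] t s(1) \<open>t < s\<close> by (auto simp: T_def)
    moreover have "K * s < K * t + K * \<eta>"
      using s(2) K(1) by (simp flip: distrib_left)
    moreover have "K * \<eta> = c q + K * q - (c t + K * t)"
      using K(1) by (simp add: \<eta>_def)
    ultimately show False using s(1) by (auto simp: T_def)
  qed
  \<comment> \<open>Steepness at t with the constant K puts points further left into
    \<open>T\<close>.\<close>
  have "t = p"
  proof (rule ccontr)
    assume "t \<noteq> p"
    then have "p < t" using t by simp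
    have "\<alpha> < t" "t < \<beta>"
      using subsetD[OF sub(2), of t] t by simp_all
    then obtain d where d: "d < t" "\<And>s. d < s \<and> s < t \<Longrightarrow> c s - c t > K * (t - s)"
      using steep[of t K] by blast
    define s where "s = (max d p + t) / 2"
    have s: "d < s" "s < t" "p < s" using d(1) \<open>p < t\<close> by (auto simp: s_def max_def)
    have "s \<in> T"
      using d(2)[of s] s \<open>t \<in> T\<close> t by (auto simp: T_def algebra_simps)
    then show False using cInf_lower[OF _ Tb] s by (fastforce simp: t_def)
  qed
  then show False
    using \<open>t \<in> T\<close> K by (auto simp: T_def algebra_simps)
qed

section \<open>Ekeland's principle, weak slope and deformations\<close>

text \<open>Lower semicontinuity is stated through closed sublevel sets, the form in which a
  supremum over a curve provides it. The sets \<open>R x\<close> are the lower sections of Ekeland's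
  order. Each step of the sequence almost minimizes \<open>\<Phi>\<close> over the current section,
  so the limit has nothing strictly below it. Keeping \<open>x0\<close> in the first conclusion
  yields the distance estimate used later.\<close>

lemma ekeland_variational_principle:
  fixes \<Phi> :: "'a::complete_space \<Rightarrow> real"
  assumes S: "closed S" and lsc: "\<And>r. closed {x \<in> S. \<Phi> x \<le> r}"
    and bdd: "\<And>x. x \<in> S \<Longrightarrow> b \<le> \<Phi> x" and "k > 0" and "x0 \<in> S"
  shows "\<exists>x\<in>S. \<Phi> x + k * dist x0 x \<le> \<Phi> x0 \<and> (\<forall>y\<in>S. y \<noteq> x \<longrightarrow> \<Phi> x < \<Phi> y + k * dist x y)"
proof -
  define R where "R x = {y \<in> S. \<Phi> y + k * dist x y \<le> \<Phi> x}" for x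
  have R_refl: "x \<in> R x" if "x \<in> S" for x
    using that by (simp add: R_def)
  have R_trans: "z \<in> R x" if "y \<in> R x" "z \<in> R y" for x y z
  proof -
    have "k * dist x z \<le> k * dist x y + k * dist y z"
      using \<open>k > 0\<close> dist_triangle[of x z y] by (simp flip: distrib_left)
    then show ?thesis using that by (auto simp: R_def)
  qed
  have R_bdd: "bdd_below (\<Phi> ` R x)" for x
    using bdd by (auto simp: R_def intro!: bdd_belowI)
  have step: "\<exists>y. y \<in> S \<and> y \<in> R x \<and> \<Phi> y \<le> Inf (\<Phi> ` R x) + e" if x: "x \<in> S" and "e > 0" for x and e :: real
  proof -
    have "Inf (\<Phi> ` R x) < Inf (\<Phi> ` R x) + e" using \<open>e > 0\<close> by simp
    then obtain y where "y \<in> R x" "\<Phi> y < Inf (\<Phi> ` R x) + e"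
      using cInf_lessD[of "\<Phi> ` R x" "Inf (\<Phi> ` R x) + e"] R_refl[OF x] by auto
    then show ?thesis by (auto simp: R_def)
  qed
  have "\<exists>X. \<forall>n::nat. (X n \<in> S \<and> (n = 0 \<longrightarrow> X n = x0)) \<and>
      (X (Suc n) \<in> R (X n) \<and> \<Phi> (X (Suc n)) \<le> Inf (\<Phi> ` R (X n)) + inverse (real (Suc n)))"
  proof (rule dependent_nat_choice)
    show "\<exists>x. x \<in> S \<and> ((0::nat) = 0 \<longrightarrow> x = x0)" using \<open>x0 \<in> S\<close> by blast
  next
    fix x and n :: nat
    assume "x \<in> S \<and> (n = 0 \<longrightarrow> x = x0)"
    then show "\<exists>y. (y \<in> S \<and> (Suc n = 0 \<longrightarrow> y = x0)) \<and>
        y \<in> R x \<and> \<Phi> y \<le> Inf (\<Phi> ` R x) + inverse (real (Suc n))"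
      using step[of x "inverse (real (Suc n))"] by simp
  qed
  then obtain X where X: "\<And>n. X n \<in> S" "X 0 = x0" "\<And>n. X (Suc n) \<in> R (X n)"
    and near_inf: "\<And>n. \<Phi> (X (Suc n)) \<le> Inf (\<Phi> ` R (X n)) + inverse (real (Suc n))"
    by blast
  have XR: "X n \<in> R (X m)" if "m \<le> n" for m n
    using that
  proof (induction n rule: dec_induct)
    case base
    then show ?case using R_refl X(1) by blast
  next
    case (step n)
    then show ?case using R_trans X(3) by blast
  qed
  have ineq: "\<Phi> (X n) + k * dist (X m) (X n) \<le> \<Phi> (X m)" if "m \<le> n" for m n
    using XR[OF that] by (simp add: R_def)
  have anti: "\<Phi> (X n) \<le> \<Phi> (X m)" if "m \<le> n" for m n
    using ineq[OF that] \<open>k > 0\<close> by (smt (verit) mult_nonneg_nonneg zero_le_dist)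
  have conv: "convergent (\<lambda>n. \<Phi> (X n))"
  proof -
    have "decseq (\<lambda>n. \<Phi> (X n))" using anti by (simp add: decseq_def)
    moreover have "\<forall>n. b \<le> \<Phi> (X n)" using bdd X(1) by blast
    ultimately show ?thesis by (metis decseq_convergent convergent_def)
  qed
  have "Cauchy X"
  proof (rule metric_CauchyI)
    fix e :: real assume "e > 0"
    have "Cauchy (\<lambda>n. \<Phi> (X n))" using conv by (simp add: Cauchy_convergent_iff)
    then obtain N where N: "\<And>m n. m \<ge> N \<Longrightarrow> n \<ge> N \<Longrightarrow> dist (\<Phi> (X m)) (\<Phi> (X n)) < k * e"
      using \<open>e > 0\<close> \<open>k > 0\<close> by (meson metric_CauchyD mult_pos_pos)
    have *: "dist (X m) (X n) < e" if "m \<ge> N" "m \<le> n" for m n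
    proof -
      have "k * dist (X m) (X n) < k * e"
        using ineq[OF that(2)] N[of m n] that by (auto simp: dist_real_def)
      then show ?thesis using \<open>k > 0\<close> by simp
    qed
    then show "\<exists>M. \<forall>m\<ge>M. \<forall>n\<ge>M. dist (X m) (X n) < e"
      by (metis dist_commute nle_le)
  qed
  then obtain x where x: "X \<longlonglongrightarrow> x"
    using Cauchy_convergent convergent_def by blast
  have limR: "x \<in> R (X m)" for m
  proof -
    have "x \<in> S" using closed_sequentially[OF S X(1) x] .
    \<comment> \<open>Closedness of sublevel sets concerns a fixed threshold, whereas here the
      threshold moves with n; relaxing it by e makes it constant for large n.\<close>
    have "\<Phi> x \<le> \<Phi> (X m) - k * dist (X m) x + e" if "e > 0" for e
    proof -
      have "(\<lambda>n. \<Phi> (X m) - k * dist (X m) (X n)) \<longlonglongrightarrow> \<Phi> (X m) - k * dist (X m) x"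
        by (intro tendsto_intros x)
      then have "\<forall>\<^sub>F n in sequentially. \<Phi> (X m) - k * dist (X m) (X n) < \<Phi> (X m) - k * dist (X m) x + e"
        using that by (intro order_tendstoD(2)[of _ _ _ "_ + e"]) auto
      with eventually_ge_at_top[of m]
      have "\<forall>\<^sub>F n in sequentially. X n \<in> {y \<in> S. \<Phi> y \<le> \<Phi> (X m) - k * dist (X m) x + e}"
      proof eventually_elim
        case (elim n)
        then show ?case using ineq[of m n] X(1) by auto
      qed
      from Lim_in_closed_set[OF lsc this _ x] show ?thesis by simp
    qed
    then have "\<Phi> x \<le> \<Phi> (X m) - k * dist (X m) x" by (rule field_le_epsilon)
    with \<open>x \<in> S\<close> show ?thesis by (simp add: R_def)
  qed
  have "\<Phi> x < \<Phi> y + k * dist x y" if y: "y \<in> S" "y \<noteq> x" for y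
  proof (rule ccontr)
    assume "\<not> ?thesis"
    then have yR: "y \<in> R x" using y by (simp add: R_def)
    \<comment> \<open>By transitivity y lies in every \<open>R (X n)\<close>, so it cannot be below
      the infimum that \<open>X (Suc n)\<close> almost attains.\<close>
    have "\<Phi> x - \<Phi> y \<le> inverse (real (Suc n))" for n
    proof -
      have "Inf (\<Phi> ` R (X n)) \<le> \<Phi> y"
        using R_trans[OF limR yR] R_bdd by (auto intro: cInf_lower)
      moreover have "\<Phi> x \<le> \<Phi> (X (Suc n))"
        using limR[of "Suc n"] \<open>k > 0\<close> by (smt (verit) R_def mem_Collect_eq mult_nonneg_nonneg zero_le_dist)
      ultimately show ?thesis using near_inf[of n] by simp
    qed
    then have "\<Phi> x - \<Phi> y \<le> 0"
      by (intro LIMSEQ_le_const[OF LIMSEQ_inverse_real_of_nat]) auto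
    moreover have "k * dist x y > 0" using y \<open>k > 0\<close> by simp
    ultimately show False using yR by (simp add: R_def)
  qed
  then show ?thesis
    using limR[of 0] X(2) by (auto simp: R_def)
qed

section \<open>Lower semicontinuity of the weak slope\<close>

lemma weak_slope_gtD:
  assumes "weak_slope g u > ennreal k" "k \<ge> 0"
  obtains \<sigma> \<delta> \<H> where "\<sigma> > k" "\<delta> > 0" "continuous_on (ball u \<delta> \<times> {0..\<delta>}) (\<lambda>(v, t). \<H> v t)"
    "\<And>v t. v \<in> ball u \<delta> \<Longrightarrow> t \<in> {0..\<delta>} \<Longrightarrow> dist (\<H> v t) v \<le> t"
    "\<And>v t. v \<in> ball u \<delta> \<Longrightarrow> t \<in> {0..\<delta>} \<Longrightarrow> g (\<H> v t) \<le> g v - \<sigma> * t"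
proof -
  from assms(1) obtain \<sigma> where "ennreal \<sigma> > ennreal k" "\<sigma> \<ge> 0"
    and *: "\<exists>\<delta>>0. \<exists>\<H>. continuous_on (ball u \<delta> \<times> {0..\<delta>}) (\<lambda>(v, t). \<H> v t) \<and>
        (\<forall>v\<in>ball u \<delta>. \<forall>t\<in>{0..\<delta>}. dist (\<H> v t) v \<le> t \<and> g (\<H> v t) \<le> g v - \<sigma> * t)"
    unfolding weak_slope_def less_Sup_iff by blast
  moreover from this have "\<sigma> > k" using assms(2) by (simp add: ennreal_less_iff)
  ultimately show ?thesis using that by blast
qed

text \<open>The deformation that works at \<open>u\<close> also works at every \<open>v\<close> in
  the ball of half the radius, once restricted to the half ball about \<open>v\<close> and to half
  the time.\<close>

lemma eventually_weak_slope_gt: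
  assumes "weak_slope g u > ennreal k" "k \<ge> 0"
  shows "\<forall>\<^sub>F v in nhds u. weak_slope g v > ennreal k"
proof -
  obtain \<sigma> \<delta> \<H> where \<sigma>: "\<sigma> > k" and \<delta>: "\<delta> > 0"
    and cont: "continuous_on (ball u \<delta> \<times> {0..\<delta>}) (\<lambda>(v, t). \<H> v t)"
    and H: "\<And>v t. v \<in> ball u \<delta> \<Longrightarrow> t \<in> {0..\<delta>} \<Longrightarrow> dist (\<H> v t) v \<le> t"
      "\<And>v t. v \<in> ball u \<delta> \<Longrightarrow> t \<in> {0..\<delta>} \<Longrightarrow> g (\<H> v t) \<le> g v - \<sigma> * t"
    using weak_slope_gtD[OF assms] by blast
  have "ennreal k < weak_slope g v" if v: "v \<in> ball u (\<delta> / 2)" for v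
  proof -
    have sub: "ball v (\<delta> / 2) \<subseteq> ball u \<delta>"
    proof
      fix w assume "w \<in> ball v (\<delta> / 2)"
      then show "w \<in> ball u \<delta>" using v dist_triangle[of u w v] by simp
    qed
    have "continuous_on (ball v (\<delta> / 2) \<times> {0..\<delta> / 2}) (\<lambda>(v, t). \<H> v t)"
      by (rule continuous_on_subset[OF cont]) (use sub \<delta> in auto)
    moreover have "\<forall>w\<in>ball v (\<delta> / 2). \<forall>t\<in>{0..\<delta> / 2}. dist (\<H> w t) w \<le> t \<and> g (\<H> w t) \<le> g w - \<sigma> * t"
      using H sub \<delta> by auto
    moreover have "\<delta> / 2 > 0" "\<sigma> \<ge> 0" using \<sigma> \<delta> assms(2) by auto
    ultimately have "ennreal \<sigma> \<le> weak_slope g v"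
      unfolding weak_slope_def by (intro Sup_upper) blast
    moreover have "ennreal k < ennreal \<sigma>"
      using \<sigma> assms(2) by (simp add: ennreal_less_iff)
    ultimately show ?thesis by simp
  qed
  then show ?thesis
    using \<delta> by (auto intro!: eventually_nhds_in_open[of "ball u (\<delta> / 2)", THEN eventually_mono])
qed

lemma weak_slope_eq_0_limit:
  assumes "u \<longlonglongrightarrow> x" "(\<lambda>n. weak_slope g (u n)) \<longlonglongrightarrow> 0"
  shows "weak_slope g x = 0"
proof (rule ccontr)
  assume "weak_slope g x \<noteq> 0"
  then obtain e where e: "0 < e" "e < weak_slope g x"
    by (metis dense not_gr_zero)
  then obtain k where k: "0 < k" "ennreal k < weak_slope g x"
    by (cases e) (auto simp: top.not_eq_extremum)
  have "\<forall>\<^sub>F n in sequentially. weak_slope g (u n) > ennreal k"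
    using eventually_weak_slope_gt[of k g x] k assms(1) by (auto simp: filterlim_iff)
  moreover have "\<forall>\<^sub>F n in sequentially. weak_slope g (u n) < ennreal k"
    using assms(2) k(1) by (intro order_tendstoD(2)) auto
  ultimately have "\<forall>\<^sub>F n::nat in sequentially. False"
    by eventually_elim auto
  then show False by simp
qed

text \<open>
  The new curve applies the local deformation on \<open>U\<close> and equals \<open>\<eta>\<close> elsewhere; it is continuous
  across the boundary of \<open>U\<close> because \<open>dist (\<H> v t) v \<le> t\<close> and the running time \<open>s * \<psi> t\<close> vanishes
  there.
\<close>
lemma local_deformation_step:
  fixes \<eta>0 \<eta> :: "'e::t2_space \<Rightarrow> 'x::metric_space"
  assumes cont: "continuous_on UNIV \<eta>" "continuous_on UNIV \<psi>"
    and U: "open U" "\<And>t. t \<in> U \<Longrightarrow> \<eta>0 t \<in> ball u (\<delta> / 2)"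
    and psi: "\<And>t. 0 \<le> \<psi> t" "\<And>t. t \<notin> U \<Longrightarrow> \<psi> t = 0"
    and P: "\<And>t. P t + \<psi> t \<le> 1" "\<And>t. dist (\<eta> t) (\<eta>0 t) \<le> s * P t"
    and s: "0 < s" "s \<le> \<delta> / 2"
    and H: "continuous_on (ball u \<delta> \<times> {0..\<delta>}) (\<lambda>(v, t). \<H> v t)"
      "\<And>v t. v \<in> ball u \<delta> \<Longrightarrow> t \<in> {0..\<delta>} \<Longrightarrow> dist (\<H> v t) v \<le> t"
      "\<And>v t. v \<in> ball u \<delta> \<Longrightarrow> t \<in> {0..\<delta>} \<Longrightarrow> g (\<H> v t) \<le> g v - \<sigma> * t"
  shows "\<exists>\<eta>'. continuous_on UNIV \<eta>' \<and> (\<forall>t. dist (\<eta>' t) (\<eta>0 t) \<le> s * (P t + \<psi> t)) \<and>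
    (\<forall>t. g (\<eta>' t) \<le> g (\<eta> t) - \<sigma> * (s * \<psi> t))"
proof -
  have P0: "0 \<le> P t" for t
    using P(2)[of t] s(1) by (meson order_trans zero_le_dist zero_le_mult_iff not_less)
  \<comment> \<open>Only \<open>\<eta>0 t\<close> is known to lie in the half ball. The earlier
    moves displace it by at most s \<le> \<delta> / 2, so \<open>\<eta> t\<close> is still where the
    deformation is defined.\<close>
  have dom: "\<eta> t \<in> ball u \<delta>" "s * \<psi> t \<in> {0..\<delta>}" if "t \<in> U" for t
  proof -
    have "s * P t \<le> s" "s * \<psi> t \<le> s"
      using P(1)[of t] P0[of t] psi(1)[of t] s(1) by (auto simp: mult_le_cancel_left2)
    moreover have "0 \<le> s * \<psi> t" using s(1) psi(1) by simp
    ultimately show "\<eta> t \<in> ball u \<delta>" "s * \<psi> t \<in> {0..\<delta>}"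
      using U(2)[OF that] P(2)[of t] s dist_triangle[of u "\<eta> t" "\<eta>0 t"]
      unfolding mem_ball atLeastAtMost_iff dist_commute[of "\<eta>0 t"] by linarith+
  qed
  define \<eta>' where "\<eta>' t = (if t \<in> U then \<H> (\<eta> t) (s * \<psi> t) else \<eta> t)" for t
  have close: "dist (\<eta>' t) (\<eta> t) \<le> s * \<psi> t" for t
    using H(2)[OF dom[of t]] psi(2)[of t] by (cases "t \<in> U") (simp_all add: \<eta>'_def)
  have contU: "continuous_on U \<eta>'"
  proof -
    have "continuous_on U (\<lambda>t. (\<lambda>(v, t). \<H> v t) (\<eta> t, s * \<psi> t))"
      using dom by (intro continuous_on_compose2[OF H(1)] continuous_intros
          continuous_on_subset[OF cont(1)] continuous_on_subset[OF cont(2)]) auto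
    then show ?thesis by (simp add: \<eta>'_def cong: continuous_on_cong)
  qed
  have "isCont \<eta>' t" for t
  proof (cases "t \<in> U")
    case True
    then show ?thesis using contU U(1) by (simp add: continuous_on_eq_continuous_at)
  next
    case False
    have [simp]: "\<eta>' t = \<eta> t" "\<psi> t = 0" using False psi by (auto simp: \<eta>'_def)
    have ct: "(\<eta> \<longlongrightarrow> \<eta> t) (at t)" "(\<psi> \<longlongrightarrow> \<psi> t) (at t)"
      using cont by (simp_all only: continuous_on_eq_continuous_at[OF open_UNIV] isCont_def UNIV_I ball_simps)
    have "((\<lambda>x. s * \<psi> x + dist (\<eta> x) (\<eta> t)) \<longlongrightarrow> s * \<psi> t + dist (\<eta> t) (\<eta> t)) (at t)"
      by (intro tendsto_intros ct)
    then have lim: "((\<lambda>x. s * \<psi> x + dist (\<eta> x) (\<eta> t)) \<longlongrightarrow> 0) (at t)" by simp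
    have "dist (\<eta>' x) (\<eta>' t) \<le> s * \<psi> x + dist (\<eta> x) (\<eta> t)" for x
      using close[of x] dist_triangle[of "\<eta>' x" "\<eta> t" "\<eta> x"] by simp
    then have "((\<lambda>x. dist (\<eta>' x) (\<eta>' t)) \<longlongrightarrow> 0) (at t)"
      by (intro tendsto_sandwich[OF _ _ tendsto_const lim] always_eventually allI) simp_all
    then have "(\<eta>' \<longlongrightarrow> \<eta>' t) (at t)" by (subst tendsto_dist_iff)
    then show ?thesis by (simp add: isCont_def)
  qed
  then have "continuous_on UNIV \<eta>'"
    by (simp add: continuous_on_eq_continuous_at)
  moreover have "dist (\<eta>' t) (\<eta>0 t) \<le> s * (P t + \<psi> t)" for t
    using close[of t] P(2)[of t] dist_triangle[of "\<eta>' t" "\<eta>0 t" "\<eta> t"]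
    by (simp add: distrib_left)
  moreover have "g (\<eta>' t) \<le> g (\<eta> t) - \<sigma> * (s * \<psi> t)" for t
    using H(3)[OF dom[of t]] psi(2)[of t] by (cases "t \<in> U") (simp_all add: \<eta>'_def)
  ultimately show ?thesis by (intro exI[of _ \<eta>'] conjI allI)
qed

text \<open>This is the witness condition inside \<open>weak_slope\<close> with the radius exposed,
  because a finite cover must choose one running time below half of all its radii.\<close>

definition descends_on :: "('x::metric_space \<Rightarrow> real) \<Rightarrow> real \<Rightarrow> 'x \<Rightarrow> real \<Rightarrow> bool" where
  "descends_on g \<sigma> u \<delta> \<longleftrightarrow> \<delta> > 0 \<and> (\<exists>\<H>. continuous_on (ball u \<delta> \<times> {0..\<delta>}) (\<lambda>(v, t). \<H> v t) \<and>
     (\<forall>v\<in>ball u \<delta>. \<forall>t\<in>{0..\<delta>}. dist (\<H> v t) v \<le> t \<and> g (\<H> v t) \<le> g v - \<sigma> * t))"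

lemma weak_slope_gt_imp_descends_on:
  assumes "weak_slope g u > ennreal k" "k \<ge> 0"
  shows "\<exists>\<delta>. descends_on g k u \<delta>"
proof -
  obtain \<sigma> \<delta> \<H> where H: "\<sigma> > k" "\<delta> > 0" "continuous_on (ball u \<delta> \<times> {0..\<delta>}) (\<lambda>(v, t). \<H> v t)"
    "\<And>v t. v \<in> ball u \<delta> \<Longrightarrow> t \<in> {0..\<delta>} \<Longrightarrow> dist (\<H> v t) v \<le> t"
    "\<And>v t. v \<in> ball u \<delta> \<Longrightarrow> t \<in> {0..\<delta>} \<Longrightarrow> g (\<H> v t) \<le> g v - \<sigma> * t"
    using weak_slope_gtD[OF assms] by blast
  have "g (\<H> v t) \<le> g v - k * t" if "v \<in> ball u \<delta>" "t \<in> {0..\<delta>}" for v t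
    using H(5)[OF that] mult_right_mono[of k \<sigma> t] H(1) that(2) by auto
  with H show ?thesis unfolding descends_on_def by blast
qed

text \<open>The local deformations are applied one after another, with running times s times the
  cutoffs. The cutoffs live on the parameter space of the curve, not on X, so they do not change
  when earlier steps move the curve, and the decreases add up.\<close>

lemma deformation_finite_cover:
  fixes \<eta>0 :: "'e::t2_space \<Rightarrow> 'x::metric_space" and \<psi> :: "'e set \<Rightarrow> 'e \<Rightarrow> real"
  assumes "finite \<C>" "continuous_on UNIV \<eta>0" "s > 0"
    and "\<And>U. U \<in> \<C> \<Longrightarrow> continuous_on UNIV (\<psi> U)"
    and "\<And>U t. U \<in> \<C> \<Longrightarrow> 0 \<le> \<psi> U t"
    and "\<And>U t. U \<in> \<C> \<Longrightarrow> t \<notin> U \<Longrightarrow> \<psi> U t = 0"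
    and "\<And>t. (\<Sum>U\<in>\<C>. \<psi> U t) \<le> 1"
    and "\<And>U. U \<in> \<C> \<Longrightarrow> open U \<and> (\<exists>u \<delta>. descends_on g \<sigma> u \<delta> \<and> s \<le> \<delta> / 2 \<and> \<eta>0 ` U \<subseteq> ball u (\<delta> / 2))"
  shows "\<exists>\<eta>. continuous_on UNIV \<eta> \<and> (\<forall>t. dist (\<eta> t) (\<eta>0 t) \<le> s * (\<Sum>U\<in>\<C>. \<psi> U t)) \<and>
    (\<forall>t. g (\<eta> t) \<le> g (\<eta>0 t) - \<sigma> * (s * (\<Sum>U\<in>\<C>. \<psi> U t)))"
  using assms
proof (induction \<C>)
  case empty
  then show ?case by (intro exI[of _ \<eta>0]) auto
next
  case (insert U \<C>)
  let ?P = "\<lambda>t. \<Sum>U\<in>\<C>. \<psi> U t"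
  have sum_insert: "(\<Sum>U\<in>insert U \<C>. \<psi> U t) = ?P t + \<psi> U t" for t
    using insert.hyps by simp
  have "\<And>t. ?P t \<le> 1"
    using insert.prems(6) insert.prems(4)[of U] unfolding sum_insert by (smt (verit) insertI1)
  with insert obtain \<eta> where \<eta>: "continuous_on UNIV \<eta>" "\<And>t. dist (\<eta> t) (\<eta>0 t) \<le> s * ?P t"
      "\<And>t. g (\<eta> t) \<le> g (\<eta>0 t) - \<sigma> * (s * ?P t)"
    by auto
  obtain u \<delta> \<H> where U: "open U" "s \<le> \<delta> / 2" "\<eta>0 ` U \<subseteq> ball u (\<delta> / 2)"
    and H: "continuous_on (ball u \<delta> \<times> {0..\<delta>}) (\<lambda>(v, t). \<H> v t)"
      "\<And>v t. v \<in> ball u \<delta> \<Longrightarrow> t \<in> {0..\<delta>} \<Longrightarrow> dist (\<H> v t) v \<le> t"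
      "\<And>v t. v \<in> ball u \<delta> \<Longrightarrow> t \<in> {0..\<delta>} \<Longrightarrow> g (\<H> v t) \<le> g v - \<sigma> * t"
    using insert.prems(7)[of U] unfolding descends_on_def by auto
  have "\<exists>\<eta>'. continuous_on UNIV \<eta>' \<and> (\<forall>t. dist (\<eta>' t) (\<eta>0 t) \<le> s * (?P t + \<psi> U t)) \<and>
      (\<forall>t. g (\<eta>' t) \<le> g (\<eta> t) - \<sigma> * (s * \<psi> U t))"
  proof (rule local_deformation_step[OF \<eta>(1) _ U(1) _ _ _ _ \<eta>(2) \<open>s > 0\<close> U(2) H])
    show "?P t + \<psi> U t \<le> 1" for t using insert.prems(6) unfolding sum_insert .
    show "\<eta>0 t \<in> ball u (\<delta> / 2)" if "t \<in> U" for t using U(3) that by blast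
  qed (use insert.prems(3,4,5) in simp_all)
  then obtain \<eta>' where \<eta>': "continuous_on UNIV \<eta>'"
      "\<And>t. dist (\<eta>' t) (\<eta>0 t) \<le> s * (?P t + \<psi> U t)"
      "\<And>t. g (\<eta>' t) \<le> g (\<eta> t) - \<sigma> * (s * \<psi> U t)"
    by blast
  have "g (\<eta>' t) \<le> g (\<eta>0 t) - \<sigma> * (s * (?P t + \<psi> U t))" for t
    using \<eta>'(3)[of t] \<eta>(3)[of t] by (simp add: algebra_simps)
  with \<eta>' show ?case unfolding sum_insert by blast
qed

text \<open>The set \<open>W\<close> is chosen before \<open>s\<close>: the caller first bounds
  \<open>g\<close> along the curve outside \<open>W\<close> and only then picks a small
  \<open>s\<close>.\<close>

lemma deformation_near_compact:
  fixes \<eta>0 :: "'e::metric_space \<Rightarrow> 'x::metric_space"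
  assumes K: "compact K" and Z: "closed Z" "K \<inter> Z = {}"
    and \<eta>0: "continuous_on UNIV \<eta>0" and "\<sigma> > 0"
    and slope: "\<And>t. t \<in> K \<Longrightarrow> weak_slope g (\<eta>0 t) > ennreal \<sigma>"
  shows "\<exists>W s0. open W \<and> K \<subseteq> W \<and> s0 > 0 \<and> (\<forall>s. 0 < s \<and> s \<le> s0 \<longrightarrow> (\<exists>\<eta>. continuous_on UNIV \<eta> \<and>
    (\<forall>t\<in>Z. \<eta> t = \<eta>0 t) \<and> (\<forall>t. dist (\<eta> t) (\<eta>0 t) \<le> s) \<and> (\<forall>t. g (\<eta> t) \<le> g (\<eta>0 t)) \<and>
    (\<forall>t\<in>W. g (\<eta> t) \<le> g (\<eta>0 t) - \<sigma> / 2 * s)))"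
proof -
  have "\<forall>t. \<exists>\<delta>. t \<in> K \<longrightarrow> descends_on g \<sigma> (\<eta>0 t) \<delta>"
    using weak_slope_gt_imp_descends_on slope \<open>\<sigma> > 0\<close> by (metis less_imp_le)
  then obtain \<delta> where \<delta>: "\<And>t. t \<in> K \<Longrightarrow> descends_on g \<sigma> (\<eta>0 t) (\<delta> t)" by metis
  then have \<delta>_pos: "\<And>t. t \<in> K \<Longrightarrow> \<delta> t > 0" by (auto simp: descends_on_def)
  \<comment> \<open>Removing \<open>Z\<close> makes all cutoffs vanish there, so the curve stays
    fixed on \<open>Z\<close>.\<close>
  define V where "V t = \<eta>0 -` ball (\<eta>0 t) (\<delta> t / 2) - Z" for t
  have V_open: "open (V t)" for t
    unfolding V_def using \<eta>0 Z(1) by (intro open_Diff) (auto intro: open_vimage)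
  have V_mem: "t \<in> V t" if "t \<in> K" for t
    using that Z(2) \<delta>_pos by (auto simp: V_def)
  obtain T where T: "T \<subseteq> K" "finite T" "K \<subseteq> (\<Union>t\<in>T. V t)"
  proof (rule compactE_image[OF K, of K V])
    show "K \<subseteq> (\<Union>t\<in>K. V t)" using V_mem by blast
  qed (use V_open in auto)
  define \<C> where "\<C> = V ` T"
  have fin: "finite \<C>" using T(2) by (simp add: \<C>_def)
  have ex: "\<exists>t\<in>T. U = V t" if "U \<in> \<C>" for U using that by (auto simp: \<C>_def)
  have notin: "- K \<notin> \<C>" using V_mem T(1) by (force simp: \<C>_def)
  \<comment> \<open>The complement of \<open>K\<close> completes the cover to the whole space. Its
    cutoff vanishes on \<open>K\<close>, so the others sum to 1 there.\<close>
  obtain \<psi> :: "'e set \<Rightarrow> 'e \<Rightarrow> real" where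
    \<psi>: "\<And>U. U \<in> insert (- K) \<C> \<Longrightarrow> continuous_on UNIV (\<psi> U) \<and> (\<forall>x\<in>UNIV. 0 \<le> \<psi> U x)"
      "\<And>x U. U \<in> insert (- K) \<C> \<Longrightarrow> x \<in> UNIV \<Longrightarrow> x \<notin> U \<Longrightarrow> \<psi> U x = 0"
    and sum: "\<And>x. x \<in> UNIV \<Longrightarrow> supp_sum (\<lambda>U. \<psi> U x) (insert (- K) \<C>) = 1"
  proof (rule subordinate_partition_of_unity[of UNIV "insert (- K) \<C>"])
    show "UNIV \<subseteq> \<Union> (insert (- K) \<C>)" using T(3) by (auto simp: \<C>_def)
    show "open U" if "U \<in> insert (- K) \<C>" for U
      using that V_open compact_imp_closed[OF K] by (auto simp: \<C>_def)
    show "\<exists>V. open V \<and> x \<in> V \<and> finite {U \<in> insert (- K) \<C>. U \<inter> V \<noteq> {}}" for x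
      using fin by (intro exI[of _ UNIV]) auto
  qed blast
  define P where "P t = (\<Sum>U\<in>\<C>. \<psi> U t)" for t
  have total: "\<psi> (- K) t + P t = 1" for t
  proof -
    have "supp_sum (\<lambda>U. \<psi> U t) (insert (- K) \<C>) = (\<Sum>U\<in>insert (- K) \<C>. \<psi> U t)"
      unfolding supp_sum_def support_on_def using fin by (intro sum.mono_neutral_left) auto
    then show ?thesis using sum[of t] fin notin by (simp add: P_def)
  qed
  have P_le: "P t \<le> 1" for t
    using total[of t] \<psi>(1)[of "- K"] by simp (smt (verit))
  have P_ge: "0 \<le> P t" for t
    unfolding P_def using \<psi>(1) by (intro sum_nonneg) simp
  have P_cont: "continuous_on UNIV P"
    unfolding P_def using \<psi>(1) by (intro continuous_on_sum) auto
  \<comment> \<open>The threshold 1/2 turns a closed condition on \<open>K\<close> into an open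
    neighbourhood, at the price of half the descent rate.\<close>
  define W where "W = {t. P t > 1 / 2}"
  define s0 where "s0 = Min (insert 1 ((\<lambda>t. \<delta> t / 2) ` T))"
  have "open W"
    unfolding W_def by (intro open_Collect_less P_cont continuous_intros)
  moreover have "K \<subseteq> W"
  proof
    fix t assume "t \<in> K"
    then have "\<psi> (- K) t = 0" using \<psi>(2) by simp
    then show "t \<in> W" using total[of t] by (simp add: W_def)
  qed
  moreover have "s0 > 0" using T(1,2) \<delta>_pos by (auto simp: s0_def)
  moreover have "\<exists>\<eta>. continuous_on UNIV \<eta> \<and> (\<forall>t\<in>Z. \<eta> t = \<eta>0 t) \<and>
      (\<forall>t. dist (\<eta> t) (\<eta>0 t) \<le> s) \<and> (\<forall>t. g (\<eta> t) \<le> g (\<eta>0 t)) \<and>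
      (\<forall>t\<in>W. g (\<eta> t) \<le> g (\<eta>0 t) - \<sigma> / 2 * s)" if s: "0 < s" "s \<le> s0" for s
  proof -
    have "open U \<and> (\<exists>u \<delta>. descends_on g \<sigma> u \<delta> \<and> s \<le> \<delta> / 2 \<and> \<eta>0 ` U \<subseteq> ball u (\<delta> / 2))"
      if U: "U \<in> \<C>" for U
    proof -
      obtain t where t: "t \<in> T" "U = V t" using ex[OF U] by blast
      have "s \<le> \<delta> t / 2" using s t(1) T(2) by (auto simp: s0_def)
      moreover have "\<eta>0 ` U \<subseteq> ball (\<eta>0 t) (\<delta> t / 2)" using t(2) by (auto simp: V_def)
      ultimately show ?thesis using \<delta> V_open t T(1) by blast
    qed
    note local = this
    have "\<exists>\<eta>. continuous_on UNIV \<eta> \<and> (\<forall>t. dist (\<eta> t) (\<eta>0 t) \<le> s * P t) \<and>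
        (\<forall>t. g (\<eta> t) \<le> g (\<eta>0 t) - \<sigma> * (s * P t))"
      unfolding P_def
    proof (rule deformation_finite_cover[OF fin \<eta>0 s(1)])
      show "(\<Sum>U\<in>\<C>. \<psi> U t) \<le> 1" for t using P_le[of t] by (simp add: P_def)
    qed (use \<psi> local in simp_all)
    then obtain \<eta> where \<eta>: "continuous_on UNIV \<eta>" "\<And>t. dist (\<eta> t) (\<eta>0 t) \<le> s * P t"
        "\<And>t. g (\<eta> t) \<le> g (\<eta>0 t) - \<sigma> * (s * P t)"
      by blast
    have "\<eta> t = \<eta>0 t" if "t \<in> Z" for t
    proof -
      have "P t = 0"
        unfolding P_def using that ex \<psi>(2) by (intro sum.neutral) (fastforce simp: V_def)
      then show ?thesis using \<eta>(2)[of t] by simp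
    qed
    moreover have "dist (\<eta> t) (\<eta>0 t) \<le> s" for t
      using \<eta>(2)[of t] P_le[of t] s(1) mult_left_mono[of "P t" 1 s] by linarith
    moreover have "g (\<eta> t) \<le> g (\<eta>0 t)" for t
      using \<eta>(3)[of t] P_ge[of t] s(1) \<open>\<sigma> > 0\<close> by (smt (verit) mult_nonneg_nonneg)
    moreover have "g (\<eta> t) \<le> g (\<eta>0 t) - \<sigma> / 2 * s" if "t \<in> W" for t
    proof -
      have "\<sigma> * s * (1 / 2) \<le> \<sigma> * s * P t"
        using that s(1) \<open>\<sigma> > 0\<close> by (intro mult_left_mono) (auto simp: W_def)
      then show ?thesis using \<eta>(3)[of t] by (simp add: mult.assoc)
    qed
    ultimately show ?thesis using \<eta>(1) by blast
  qed
  ultimately show ?thesis by blast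
qed

text \<open>
  Ekeland's principle is applied to the curves that coincide with \<open>\<gamma>\<close> wherever \<open>g (\<gamma> t) \<le> b\<close>, not
  only on the sphere: this is what makes the almost critical point lie near a high point of \<open>\<gamma>\<close>.
\<close>
lemma minimax_almost_critical_point:
  fixes \<gamma> :: "'e::euclidean_space \<Rightarrow> 'x::complete_space" and g :: "'x \<Rightarrow> real"
  assumes g: "continuous_on UNIV g" and \<gamma>: "continuous_on (cball 0 1) \<gamma>"
    and sphere: "\<And>t. t \<in> sphere 0 1 \<Longrightarrow> g (\<gamma> t) \<le> b" and "b < c"
    and level: "\<And>\<eta>. continuous_on (cball 0 1) \<eta> \<Longrightarrow> (\<And>t. t \<in> sphere 0 1 \<Longrightarrow> \<eta> t = \<gamma> t) \<Longrightarrow>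
      \<exists>t\<in>cball 0 1. c \<le> g (\<eta> t)"
    and top: "\<And>t. t \<in> cball 0 1 \<Longrightarrow> g (\<gamma> t) \<le> c + k\<^sup>2" and "k > 0"
  shows "\<exists>t\<in>cball 0 1. \<exists>u. b < g (\<gamma> t) \<and> dist (\<gamma> t) u \<le> k \<and> c \<le> g u \<and> g u \<le> c + k\<^sup>2 \<and>
    weak_slope g u \<le> ennreal (2 * k)"
proof -
  let ?D = "cball (0::'e) 1"
  \<comment> \<open>Extending the curve by the metric projection makes it a bounded continuous
    function on the whole space, hence a point of a complete metric space.\<close>
  have "continuous_on UNIV (closest_point ?D)"
    by (intro continuous_on_closest_point) auto
  moreover have closest_in: "closest_point ?D t \<in> ?D" for t
    by (rule closest_point_in_set) auto
  ultimately have ext_cont: "continuous_on UNIV (\<gamma> \<circ> closest_point ?D)"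
    by (intro continuous_on_compose continuous_on_subset[OF \<gamma>]) auto
  have "bounded (range (\<gamma> \<circ> closest_point ?D))"
    using compact_imp_bounded[OF compact_continuous_image[OF \<gamma> compact_cball]] closest_in
    by (auto elim!: bounded_subset)
  with ext_cont have "\<gamma> \<circ> closest_point ?D \<in> bcontfun" by (simp add: bcontfun_def)
  then obtain F0 :: "'e \<Rightarrow>\<^sub>C 'x" where F0: "\<gamma> \<circ> closest_point ?D = apply_bcontfun F0"
    by (rule bcontfunE)
  have F0_eq: "F0 t = \<gamma> t" if "t \<in> ?D" for t
    using that by (simp flip: F0 add: closest_point_self)
  define Z where "Z = {t. t \<notin> ball 0 1 \<or> g (F0 t) \<le> b}"
  have g_comp: "continuous_on UNIV (\<lambda>t. g (F t))" for F :: "'e \<Rightarrow>\<^sub>C 'x"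
    by (rule continuous_on_compose2[OF g]) auto
  have "Z = (- ball 0 1) \<union> {t. g (F0 t) \<le> b}" by (auto simp: Z_def)
  then have "closed Z"
    by (simp only:) (intro closed_Un closed_Collect_le g_comp continuous_intros, auto)
  have sphere_Z: "t \<in> Z" if "t \<in> sphere 0 1" for t
    using that by (simp add: Z_def)
  have low: "g (F0 t) \<le> b" if "t \<in> Z" "t \<in> ?D" for t
    using that sphere[of t] F0_eq[of t] by (auto simp: Z_def)
  define S where "S = {F :: 'e \<Rightarrow>\<^sub>C 'x. \<forall>t\<in>Z. F t = F0 t}"
  have eval: "continuous_on UNIV (\<lambda>F :: 'e \<Rightarrow>\<^sub>C 'x. F t)" for t
    unfolding continuous_on_iff by (metis dist_bounded le_less_trans)
  have "closed S"
    unfolding S_def Ball_def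
    by (intro closed_Collect_all closed_Collect_imp closed_Collect_eq eval continuous_intros) auto
  define \<Phi> where "\<Phi> F = Sup ((\<lambda>t. g (F t)) ` ?D)" for F :: "'e \<Rightarrow>\<^sub>C 'x"
  have bddD: "bdd_above ((\<lambda>t. g (F t)) ` ?D)" for F :: "'e \<Rightarrow>\<^sub>C 'x"
    by (intro bounded_imp_bdd_above compact_imp_bounded compact_continuous_image
        continuous_on_subset[OF g_comp]) auto
  have \<Phi>_le_iff: "\<Phi> F \<le> r \<longleftrightarrow> (\<forall>t\<in>?D. g (F t) \<le> r)" for F :: "'e \<Rightarrow>\<^sub>C 'x" and r
    unfolding \<Phi>_def using bddD by (subst cSUP_le_iff) auto
  have \<Phi>_upper: "g (F t) \<le> \<Phi> F" if "t \<in> ?D" for F :: "'e \<Rightarrow>\<^sub>C 'x" and t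
    using \<Phi>_le_iff[of F "\<Phi> F"] that by blast
  have c_le: "c \<le> \<Phi> F" if "F \<in> S" for F
  proof -
    have "F t = \<gamma> t" if "t \<in> sphere 0 1" for t
      using that \<open>F \<in> S\<close> sphere_Z F0_eq[of t] by (simp add: S_def)
    then obtain t where "t \<in> ?D" "c \<le> g (F t)"
      using level[of F] by blast
    then show ?thesis using \<Phi>_upper by (meson order_trans)
  qed
  have lsc: "closed {F \<in> S. \<Phi> F \<le> r}" for r
  proof -
    have "{F \<in> S. \<Phi> F \<le> r} = S \<inter> (\<Inter>t\<in>?D. {F :: 'e \<Rightarrow>\<^sub>C 'x. g (F t) \<le> r})"
      by (auto simp: \<Phi>_le_iff)
    moreover have "closed {F :: 'e \<Rightarrow>\<^sub>C 'x. g (F t) \<le> r}" for t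
      by (intro closed_Collect_le continuous_on_const continuous_on_compose2[OF g eval]) auto
    ultimately show ?thesis
      using \<open>closed S\<close> by (simp only:) (intro closed_Int closed_INT ballI, auto)
  qed
  have "F0 \<in> S" by (simp add: S_def)
  obtain F where F: "F \<in> S" "\<Phi> F + k * dist F0 F \<le> \<Phi> F0"
    and F_min: "\<And>G. G \<in> S \<Longrightarrow> G \<noteq> F \<Longrightarrow> \<Phi> F < \<Phi> G + k * dist F G"
    using ekeland_variational_principle[OF \<open>closed S\<close> lsc c_le \<open>k > 0\<close> \<open>F0 \<in> S\<close>] by blast
  have "\<Phi> F0 \<le> c + k\<^sup>2" using top F0_eq by (auto simp: \<Phi>_le_iff)
  with F(2) have near: "\<Phi> F + k * dist F0 F \<le> c + k * k" by (simp add: power2_eq_square)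
  \<comment> \<open>The excess k * k of the initial curve over \<open>c\<close>, spent at the
    Ekeland rate k, buys a displacement of at most k.\<close>
  have "k * dist F0 F \<le> k * k" using near c_le[OF F(1)] by linarith
  then have dist_F: "dist F0 F \<le> k" using \<open>k > 0\<close> by simp
  have \<Phi>F_le: "\<Phi> F \<le> c + k\<^sup>2"
    using near \<open>k > 0\<close> by (smt (verit) mult_nonneg_nonneg power2_eq_square zero_le_dist)
  define K where "K = ?D \<inter> {t. \<Phi> F \<le> g (F t)}"
  have "compact K"
    unfolding K_def by (intro compact_Int_closed closed_Collect_le g_comp continuous_intros) auto
  have "K \<inter> Z = {}"
  proof (rule ccontr)
    assume "K \<inter> Z \<noteq> {}"
    then obtain t where t: "t \<in> ?D" "\<Phi> F \<le> g (F t)" "t \<in> Z" by (auto simp: K_def)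
    then have "F t = F0 t" using F(1) by (simp add: S_def)
    then show False using low[OF t(3,1)] t(2) c_le[OF F(1)] \<open>b < c\<close> by simp
  qed
  \<comment> \<open>If the slope exceeded 2 * k on the top set, the glued deformation, which keeps
    half the rate, would lower the maximum by k * s while moving the curve by at most s. This
    violates the strict Ekeland inequality and explains the factor 2.\<close>
  have "\<exists>t\<in>K. weak_slope g (F t) \<le> ennreal (2 * k)"
  proof (rule ccontr)
    assume "\<not> ?thesis"
    then have slope: "weak_slope g (F t) > ennreal (2 * k)" if "t \<in> K" for t
      using that by (simp add: not_le)
    have "2 * k > 0" using \<open>k > 0\<close> by simp
    have F_cont: "continuous_on UNIV F" by simp
    obtain W s0 where W: "open W" "K \<subseteq> W" "s0 > 0"
      and def: "\<And>s. 0 < s \<Longrightarrow> s \<le> s0 \<Longrightarrow> \<exists>\<eta>. continuous_on UNIV \<eta> \<and>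
        (\<forall>t\<in>Z. \<eta> t = F t) \<and> (\<forall>t. dist (\<eta> t) (F t) \<le> s) \<and> (\<forall>t. g (\<eta> t) \<le> g (F t)) \<and>
        (\<forall>t\<in>W. g (\<eta> t) \<le> g (F t) - (2 * k) / 2 * s)"
      using deformation_near_compact[OF \<open>compact K\<close> \<open>closed Z\<close> \<open>K \<inter> Z = {}\<close> F_cont \<open>2 * k > 0\<close> slope]
      by blast
    \<comment> \<open>Outside \<open>W\<close> the curve need not descend. Compactness leaves a gap
      below the maximum, and s is taken so small that k * s fits into it.\<close>
    have "\<exists>m<\<Phi> F. \<forall>t\<in>?D - W. g (F t) \<le> m"
    proof (cases "?D - W = {}")
      case True
      then show ?thesis by (intro exI[of _ "\<Phi> F - 1"]) auto
    next
      case False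
      have "compact (?D - W)" using W(1) by (intro compact_diff) auto
      then obtain t where t: "t \<in> ?D - W" "\<And>s. s \<in> ?D - W \<Longrightarrow> g (F s) \<le> g (F t)"
        using continuous_attains_sup[OF _ False continuous_on_subset[OF g_comp]] by blast
      have "t \<notin> K" using t(1) W(2) by blast
      then have "g (F t) < \<Phi> F" using t(1) by (auto simp: K_def)
      with t(2) show ?thesis by blast
    qed
    then obtain m where m: "m < \<Phi> F" "\<And>t. t \<in> ?D - W \<Longrightarrow> g (F t) \<le> m" by blast
    define s where "s = min s0 ((\<Phi> F - m) / k)"
    have s: "0 < s" "s \<le> s0" "k * s \<le> \<Phi> F - m"
      using W(3) m(1) \<open>k > 0\<close> by (auto simp: s_def min_def field_simps)
    obtain \<eta> where \<eta>: "continuous_on UNIV \<eta>" "\<And>t. t \<in> Z \<Longrightarrow> \<eta> t = F t"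
        "\<And>t. dist (\<eta> t) (F t) \<le> s" "\<And>t. g (\<eta> t) \<le> g (F t)"
        "\<And>t. t \<in> W \<Longrightarrow> g (\<eta> t) \<le> g (F t) - k * s"
      using def[OF s(1,2)] by auto
    have "bounded (range \<eta>)"
    proof -
      obtain x r where "\<And>t. dist x (F t) \<le> r"
        using bounded_apply_bcontfun[of F] by (auto simp: bounded_def)
      then have "dist x (\<eta> t) \<le> r + s" for t
        using \<eta>(3)[of t] dist_triangle[of x "\<eta> t" "F t"] by (smt (verit) dist_commute)
      then show ?thesis by (auto simp: bounded_def)
    qed
    with \<eta>(1) have "\<eta> \<in> bcontfun" by (simp add: bcontfun_def)
    then obtain G :: "'e \<Rightarrow>\<^sub>C 'x" where G: "\<eta> = apply_bcontfun G" by (rule bcontfunE)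
    have "G \<in> S" using F(1) \<eta>(2) by (simp add: S_def G)
    have "g (G t) \<le> \<Phi> F - k * s" if t: "t \<in> ?D" for t
    proof (cases "t \<in> W")
      case True
      then show ?thesis using \<eta>(5)[of t] \<Phi>_upper[OF t, of F] by (simp add: G)
    next
      case False
      then show ?thesis using \<eta>(4)[of t] m(2)[of t] t s(3) by (simp add: G)
    qed
    then have drop: "\<Phi> G \<le> \<Phi> F - k * s" by (simp add: \<Phi>_le_iff)
    have "k * s > 0" using \<open>k > 0\<close> s(1) by simp
    with drop have "G \<noteq> F" by auto
    have "dist F G \<le> s"
      using \<eta>(3) by (intro dist_bound) (simp add: G dist_commute)
    then have "k * dist F G \<le> k * s" using \<open>k > 0\<close> by simp
    with F_min[OF \<open>G \<in> S\<close> \<open>G \<noteq> F\<close>] drop show False by linarith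
  qed
  then obtain t where t: "t \<in> K" "weak_slope g (F t) \<le> ennreal (2 * k)" ..
  have tD: "t \<in> ?D" and "\<Phi> F \<le> g (F t)" using t(1) by (auto simp: K_def)
  have "t \<notin> Z" using t(1) \<open>K \<inter> Z = {}\<close> by blast
  then have "b < g (\<gamma> t)" using F0_eq[OF tD] by (auto simp: Z_def)
  moreover have "dist (\<gamma> t) (F t) \<le> k"
    using dist_bounded[of F0 t F] dist_F F0_eq[OF tD] by simp
  moreover have "c \<le> g (F t)" "g (F t) \<le> c + k\<^sup>2"
    using c_le[OF F(1)] \<open>\<Phi> F \<le> g (F t)\<close> \<Phi>_upper[OF tD, of F] \<Phi>F_le by auto
  ultimately show ?thesis using t(2) tD by blast
qed

section \<open>Polarization of curves\<close>

lemma continuous_map_Times_top_of_set_iff: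
  "continuous_map (prod_topology (top_of_set A) (top_of_set B)) (top_of_set C) h \<longleftrightarrow>
    continuous_on (A \<times> B) h \<and> h ` (A \<times> B) \<subseteq> C"
  by (simp add: prod_topology_subtopology subtopology_subtopology Times_Int_Times image_subset_iff_funcset)

context symmetrization_framework
begin

lemma emb_diff: "emb (u - v) = emb u - emb v"
  using emb_bounded_linear by (simp add: bounded_linear.linear linear_diff)

lemma iter_pol_in: "u \<in> S \<Longrightarrow> range Hs \<subseteq> HH \<Longrightarrow> iter_pol pol u Hs m \<in> S"
  by (induction m) (auto intro: pol_in)

lemma star_iter_pol: "u \<in> S \<Longrightarrow> range Hs \<subseteq> HH \<Longrightarrow> star (iter_pol pol u Hs m) = star u"
  by (induction m) (auto simp: star_pol iter_pol_in subset_iff)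

lemma iter_pol_contraction:
  assumes "u \<in> S" "v \<in> S" "range Hs \<subseteq> HH"
  shows "norm (emb (iter_pol pol u Hs m) - emb (iter_pol pol v Hs m)) \<le> norm (emb u - emb v)"
proof (induction m)
  case (Suc m)
  have "Hs m \<in> HH" using assms(3) by blast
  have "norm (emb (iter_pol pol u Hs (Suc m)) - emb (iter_pol pol v Hs (Suc m)))
      \<le> norm (emb (iter_pol pol u Hs m) - emb (iter_pol pol v Hs m))"
    unfolding iter_pol.simps using assms \<open>Hs m \<in> HH\<close> by (intro pol_contraction iter_pol_in)
  also note Suc
  finally show ?case .
qed simp

text \<open>Nonexpansiveness of iterated polarizations passes to their limit in V.\<close>

lemma star_contraction:
  assumes "u \<in> S" "v \<in> S"
  shows "norm (emb (star u) - emb (star v)) \<le> norm (emb u - emb v)"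
proof -
  obtain Hs where Hs: "range Hs \<subseteq> HH"
    and lim: "\<And>u. u \<in> S \<Longrightarrow> (\<lambda>m. emb (iter_pol pol u Hs m)) \<longlonglongrightarrow> emb (star u)"
    using pol_approx by blast
  have "(\<lambda>m. norm (emb (iter_pol pol u Hs m) - emb (iter_pol pol v Hs m)))
      \<longlonglongrightarrow> norm (emb (star u) - emb (star v))"
    by (intro tendsto_intros lim assms)
  then show ?thesis
    by (rule LIMSEQ_le_const2) (use iter_pol_contraction[OF assms Hs] in blast)
qed

lemma ext_star_lipschitz:
  "\<exists>L\<ge>0. \<forall>u v. norm (emb (ext_star star \<Theta> u) - emb (ext_star star \<Theta> v)) \<le> L * norm (emb u - emb v)"
proof -
  obtain L where L: "\<And>u v. norm (emb (\<Theta> u) - emb (\<Theta> v)) \<le> L * norm (emb u - emb v)"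
    using Theta_lipschitz by blast
  have "norm (emb (ext_star star \<Theta> u) - emb (ext_star star \<Theta> v)) \<le> \<bar>L\<bar> * norm (emb u - emb v)" for u v
  proof -
    have "norm (emb (ext_star star \<Theta> u) - emb (ext_star star \<Theta> v)) \<le> norm (emb (\<Theta> u) - emb (\<Theta> v))"
      unfolding ext_star_def by (intro star_contraction Theta_in)
    also have "\<dots> \<le> L * norm (emb u - emb v)" by (rule L)
    also have "\<dots> \<le> \<bar>L\<bar> * norm (emb u - emb v)" by (intro mult_right_mono) auto
    finally show ?thesis .
  qed
  then show ?thesis by (intro exI[of _ "\<bar>L\<bar>"]) auto
qed

text \<open>All iterates and the limit are 1-Lipschitz for the norm of V, so pointwise convergence
  on a finite net suffices. The net is taken in X, and its radius e / (3 * B) becomes e / 3 in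
  V.\<close>

lemma iter_pol_uniform_limit:
  assumes A: "compact A" "A \<subseteq> S" and Hs: "range Hs \<subseteq> HH"
    and lim: "\<And>u. u \<in> S \<Longrightarrow> (\<lambda>m. emb (iter_pol pol u Hs m)) \<longlonglongrightarrow> emb (star u)"
  shows "uniform_limit A (\<lambda>m u. emb (iter_pol pol u Hs m)) (\<lambda>u. emb (star u)) sequentially"
proof (rule uniform_limitI)
  fix e :: real assume "e > 0"
  obtain B where B: "B > 0" "\<And>x. norm (emb x) \<le> norm x * B"
    using bounded_linear.pos_bounded[OF emb_bounded_linear] by blast
  have "e / (3 * B) > 0" using \<open>e > 0\<close> B(1) by simp
  then obtain N where N: "finite N" "N \<subseteq> A" "A \<subseteq> (\<Union>x\<in>N. ball x (e / (3 * B)))"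
    using compactE_image[OF A(1), of A "\<lambda>x. ball x (e / (3 * B))"] by force
  have "\<forall>\<^sub>F m in sequentially. \<forall>x\<in>N. dist (emb (iter_pol pol x Hs m)) (emb (star x)) < e / 3"
    using N A(2) \<open>e > 0\<close> by (intro eventually_ball_finite ballI tendstoD lim) auto
  then show "\<forall>\<^sub>F m in sequentially. \<forall>u\<in>A. dist (emb (iter_pol pol u Hs m)) (emb (star u)) < e"
  proof eventually_elim
    case (elim m)
    show ?case
    proof
      fix u assume u: "u \<in> A"
      then obtain x where x: "x \<in> N" "dist x u < e / (3 * B)" using N(3) by auto
      have S: "u \<in> S" "x \<in> S" using u x N(2) A(2) by auto
      have "norm (emb u - emb x) \<le> norm (u - x) * B" using B(2)[of "u - x"] by (simp add: emb_diff)
      also have "\<dots> < e / 3"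
        using x(2) B(1) by (simp add: dist_norm norm_minus_commute field_simps)
      finally have near: "norm (emb u - emb x) < e / 3" .
      have "norm (emb (iter_pol pol u Hs m) - emb (iter_pol pol x Hs m)) < e / 3"
        "norm (emb (star u) - emb (star x)) < e / 3"
        using iter_pol_contraction[OF S Hs, of m] star_contraction[OF S] near by auto
      then show "dist (emb (iter_pol pol u Hs m)) (emb (star u)) < e"
        using elim x(1) dist_triangle_third[of "emb (iter_pol pol u Hs m)" "emb (iter_pol pol x Hs m)" e
            "emb (star x)" "emb (star u)"]
        by (auto simp: dist_norm norm_minus_commute)
    qed
  qed
qed

lemma continuous_on_pol_const:
  assumes "H \<in> HH"
  shows "continuous_on S (\<lambda>u. pol u H)"
proof -
  have "continuous_on S (\<lambda>u. (\<lambda>(u, H). pol u H) (u, H))"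
    using assms by (intro continuous_on_compose2[OF pol_continuous] continuous_intros) auto
  then show ?thesis by simp
qed

text \<open>
  Idempotence \<open>pol_pol\<close> lets each new polarization be switched on along a path in \<open>HH\<close> that starts
  at the one applied last, so the homotopy only passes through iterated polarizations.
\<close>
lemma homotopic_iter_pol:
  assumes H0: "H0 \<in> HH" and Hs: "range Hs \<subseteq> HH"
    and R_refl: "\<And>u. u \<in> S \<Longrightarrow> R u u"
    and R_pol: "\<And>u v H. u \<in> S \<Longrightarrow> v \<in> S \<Longrightarrow> H \<in> HH \<Longrightarrow> R u v \<Longrightarrow> R u (pol v H)"
  shows "homotopic_with_canon (\<lambda>\<phi>. \<forall>u\<in>S. R u (\<phi> u)) S S
    (\<lambda>u. pol u H0) (\<lambda>u. iter_pol pol (pol u H0) Hs m)"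
proof (induction m)
  case 0
  show ?case
    using H0 by (auto simp: continuous_on_pol_const pol_in R_refl R_pol)
next
  case (Suc m)
  let ?w = "\<lambda>u. iter_pol pol (pol u H0) Hs m"
  have w_in: "?w u \<in> S" if "u \<in> S" for u
    using that H0 Hs by (simp add: iter_pol_in pol_in)
  have w_cont: "continuous_on S ?w"
    using homotopic_with_imp_continuous[OF Suc] by simp
  have wR: "R u (?w u)" if "u \<in> S" for u
    using homotopic_with_imp_property[OF Suc] that by blast
  \<comment> \<open>This is the polarization applied last, which is \<open>H0\<close> when no member
    of the sequence has been applied yet.\<close>
  define K where "K = (case m of 0 \<Rightarrow> H0 | Suc j \<Rightarrow> Hs j)"
  have K: "K \<in> HH" using H0 Hs by (auto simp: K_def split: nat.split)
  have wK: "pol (?w u) K = ?w u" if "u \<in> S" for u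
    using that H0 Hs pol_pol iter_pol_in[OF pol_in[OF that H0] Hs]
    by (cases m) (auto simp: K_def)
  have "Hs m \<in> HH" using Hs by blast
  then obtain p where p: "path p" "path_image p \<subseteq> HH" "pathstart p = K" "pathfinish p = Hs m"
    using path_connected_HH K unfolding path_connected_def by blast
  have p_in: "p s \<in> HH" if "s \<in> {0..1}" for s
    using p(2) that by (auto simp: path_image_def)
  let ?h = "\<lambda>z :: real \<times> 'x. pol (?w (snd z)) (p (fst z))"
  have h_cont: "continuous_on ({0..1} \<times> S) ?h"
  proof -
    have "continuous_on ({0..1} \<times> S) (\<lambda>z :: real \<times> 'x. (\<lambda>(u, H). pol u H) (?w (snd z), p (fst z)))"
    proof (rule continuous_on_compose2[OF pol_continuous])
      show "continuous_on ({0..1} \<times> S) (\<lambda>z :: real \<times> 'x. (?w (snd z), p (fst z)))"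
        using p(1) unfolding path_def
        by (intro continuous_on_Pair continuous_on_compose2[OF w_cont continuous_on_snd]
            continuous_on_compose2[of "{0..1}" p _ fst] continuous_intros) auto
    qed (use w_in p_in in auto)
    then show ?thesis by simp
  qed
  have "homotopic_with_canon (\<lambda>\<phi>. \<forall>u\<in>S. R u (\<phi> u)) S S ?w (\<lambda>u. iter_pol pol (pol u H0) Hs (Suc m))"
  proof (subst homotopic_with)
    show "\<exists>h. continuous_map (prod_topology (top_of_set {0..1::real}) (top_of_set S)) (top_of_set S) h \<and>
        (\<forall>x\<in>topspace (top_of_set S). h (0, x) = ?w x) \<and>
        (\<forall>x\<in>topspace (top_of_set S). h (1, x) = iter_pol pol (pol x H0) Hs (Suc m)) \<and>
        (\<forall>t\<in>{0..1}. \<forall>u\<in>S. R u (h (t, u)))"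
    proof (rule exI[where x = "?h"], intro conjI ballI)
      have "?h ` ({0..1} \<times> S) \<subseteq> S" using w_in p_in pol_in by auto
      with h_cont show "continuous_map (prod_topology (top_of_set {0..1}) (top_of_set S)) (top_of_set S) ?h"
        unfolding continuous_map_Times_top_of_set_iff by blast
    qed (use p(3,4) wK w_in p_in R_pol wR in \<open>auto simp: pathstart_def pathfinish_def\<close>)
  qed auto
  then show ?case using homotopic_with_trans[OF Suc] by blast
qed

text \<open>
  The new curve runs through the homotopy in a thin shell near the sphere, so its boundary values
  are \<open>pol (w t) H0\<close> and its values inside are highly polarized.
\<close>
lemma almost_symmetric_curve_in_S:
  fixes w :: "'e::euclidean_space \<Rightarrow> 'x"
  assumes w: "continuous_on (cball 0 1) w" "w ` cball 0 1 \<subseteq> S"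
    and H0: "H0 \<in> HH" and "\<epsilon> > 0" "\<delta> > 0"
    and R_refl: "\<And>u. u \<in> S \<Longrightarrow> R u u"
    and R_pol: "\<And>u v H. u \<in> S \<Longrightarrow> v \<in> S \<Longrightarrow> H \<in> HH \<Longrightarrow> R u v \<Longrightarrow> R u (pol v H)"
  shows "\<exists>w'. continuous_on (cball 0 1) w' \<and> w' ` cball 0 1 \<subseteq> S \<and>
    (\<forall>t\<in>sphere 0 1. w' t = pol (w t) H0) \<and> (\<forall>t\<in>cball 0 1. R (w t) (w' t)) \<and>
    (\<forall>t. norm t \<le> 1 - \<delta> \<longrightarrow> norm (emb (w' t) - emb (star (w' t))) \<le> \<epsilon>)"
proof -
  obtain Hs where Hs: "range Hs \<subseteq> HH"
    and lim: "\<And>u. u \<in> S \<Longrightarrow> (\<lambda>m. emb (iter_pol pol u Hs m)) \<longlonglongrightarrow> emb (star u)"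
    using pol_approx by blast
  let ?A = "(\<lambda>t. pol (w t) H0) ` cball 0 1"
  have A: "compact ?A" "?A \<subseteq> S"
    using continuous_on_compose2[OF continuous_on_pol_const[OF H0] w] pol_in[OF _ H0] w(2)
    by (auto intro!: compact_continuous_image)
  obtain m where m: "\<And>u. u \<in> ?A \<Longrightarrow> dist (emb (iter_pol pol u Hs m)) (emb (star u)) < \<epsilon>"
    using eventually_happens[OF uniform_limitD[OF iter_pol_uniform_limit[OF A Hs lim] \<open>\<epsilon> > 0\<close>]]
    by auto
  obtain h where h: "continuous_map (prod_topology (top_of_set {0..1::real}) (top_of_set S)) (top_of_set S) h"
      "\<And>u. h (0, u) = pol u H0" "\<And>u. h (1, u) = iter_pol pol (pol u H0) Hs m"
      "\<And>s u. s \<in> {0..1} \<Longrightarrow> u \<in> S \<Longrightarrow> R u (h (s, u))"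
    using homotopic_iter_pol[OF H0 Hs, of R m] R_refl R_pol unfolding homotopic_with_def by blast
  have h_cont: "continuous_on ({0..1} \<times> S) h" and h_in: "h ` ({0..1} \<times> S) \<subseteq> S"
    using h(1) unfolding continuous_map_Times_top_of_set_iff by blast+
  \<comment> \<open>The homotopy time is 0 on the sphere and 1 wherever the norm is at most 1 -
    \<delta>.\<close>
  define \<rho> where "\<rho> t = min 1 ((1 - norm t) / \<delta>)" for t :: 'e
  have \<rho>: "\<rho> t \<in> {0..1}" if "t \<in> cball 0 1" for t
    using that \<open>\<delta> > 0\<close> by (auto simp: \<rho>_def)
  define w' where "w' t = h (\<rho> t, w t)" for t
  have "continuous_on (cball 0 1) w'"
    unfolding w'_def
    by (rule continuous_on_compose2[OF h_cont])
      (use \<rho> w \<open>\<delta> > 0\<close> in \<open>auto simp: \<rho>_def[abs_def] intro!: continuous_intros\<close>)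
  moreover have "w' ` cball 0 1 \<subseteq> S" using h_in \<rho> w(2) by (fastforce simp: w'_def)
  moreover have "\<forall>t\<in>sphere 0 1. w' t = pol (w t) H0" by (auto simp: w'_def \<rho>_def h(2))
  moreover have "\<forall>t\<in>cball 0 1. R (w t) (w' t)" using h(4) \<rho> w(2) by (auto simp: w'_def)
  moreover have "norm (emb (w' t) - emb (star (w' t))) \<le> \<epsilon>" if "norm t \<le> 1 - \<delta>" for t
  proof -
    have t: "t \<in> cball 0 1" using that \<open>\<delta> > 0\<close> by simp
    have "\<rho> t = 1" using that \<open>\<delta> > 0\<close> by (simp add: \<rho>_def)
    then have w't: "w' t = iter_pol pol (pol (w t) H0) Hs m" by (simp add: w'_def h(3))
    have "pol (w t) H0 \<in> S" using A(2) t by blast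
    \<comment> \<open>Polarization does not change the symmetrization, so the quantity to estimate
      is exactly the one bounded by the choice of \<open>m\<close>.\<close>
    then have "star (w' t) = star (pol (w t) H0)" using Hs by (simp add: w't star_iter_pol)
    then show ?thesis using m[of "pol (w t) H0"] t by (auto simp: w't dist_norm)
  qed
  ultimately show ?thesis by blast
qed

lemma ext_star_on_S: "u \<in> S \<Longrightarrow> ext_star star \<Theta> u = star u"
  by (simp add: ext_star_def Theta_id)

end

section \<open>Critical points at minimax levels\<close>

lemma minimax_classD:
  assumes "\<gamma> \<in> minimax_class \<Gamma>0"
  shows "continuous_on (cball 0 1) \<gamma>" "restrict \<gamma> (sphere 0 1) \<in> \<Gamma>0"
  using assms by (auto simp: minimax_class_def cont_maps_def)

lemma restrict_in_minimax_class:
  assumes "continuous_on (cball 0 1) \<eta>" "restrict \<eta> (sphere 0 1) \<in> \<Gamma>0"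
  shows "restrict \<eta> (cball 0 1) \<in> minimax_class \<Gamma>0"
proof -
  have "restrict (restrict \<eta> (cball 0 1)) (sphere 0 1) = restrict \<eta> (sphere 0 1)"
    by (auto simp: restrict_def fun_eq_iff)
  moreover have "continuous_on (cball 0 1) (restrict \<eta> (cball 0 1))"
    using assms(1) by (rule continuous_on_eq) simp
  ultimately show ?thesis
    using assms(2) by (simp add: minimax_class_def cont_maps_def)
qed

lemma le_boundary_level:
  assumes "\<gamma> \<in> minimax_class \<Gamma>0" "t \<in> sphere 0 1"
  shows "ereal (g (\<gamma> t)) \<le> boundary_level \<Gamma>0 g"
proof -
  have "ereal (g (restrict \<gamma> (sphere 0 1) t)) \<le> boundary_level \<Gamma>0 g"
    unfolding boundary_level_def
    using minimax_classD(2)[OF assms(1)] assms(2) by (intro SUP_upper2[of "restrict \<gamma> (sphere 0 1)"] SUP_upper)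
  then show ?thesis using assms(2) by simp
qed

lemma minimax_curve_attains_sup:
  fixes \<gamma> :: "'e::euclidean_space \<Rightarrow> 'x::topological_space" and g :: "'x \<Rightarrow> real"
  assumes "continuous_on UNIV g" "\<gamma> \<in> minimax_class \<Gamma>0"
  shows "\<exists>t\<in>cball 0 1. (SUP t\<in>cball 0 1. ereal (g (\<gamma> t))) = ereal (g (\<gamma> t)) \<and>
    (\<forall>s\<in>cball 0 1. g (\<gamma> s) \<le> g (\<gamma> t))"
proof -
  have "continuous_on (cball 0 1) (\<lambda>t. g (\<gamma> t))"
    using minimax_classD(1)[OF assms(2)] by (intro continuous_on_compose2[OF assms(1)]) auto
  then obtain t where t: "t \<in> cball 0 1" "\<forall>s\<in>cball 0 1. g (\<gamma> s) \<le> g (\<gamma> t)"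
    using continuous_attains_sup[of "cball (0::'e) 1" "\<lambda>t. g (\<gamma> t)"] by auto
  moreover have "(SUP t\<in>cball 0 1. ereal (g (\<gamma> t))) = ereal (g (\<gamma> t))"
    using t by (intro antisym SUP_least SUP_upper) auto
  ultimately show ?thesis by blast
qed

lemma minimax_level_le_attained:
  fixes \<gamma> :: "'e::euclidean_space \<Rightarrow> 'x::topological_space"
  assumes "continuous_on UNIV g" "\<gamma> \<in> minimax_class \<Gamma>0"
  shows "\<exists>t\<in>cball 0 1. minimax_level \<Gamma>0 g \<le> ereal (g (\<gamma> t)) \<and> (\<forall>s\<in>cball 0 1. g (\<gamma> s) \<le> g (\<gamma> t))"
proof -
  obtain t where t: "t \<in> cball 0 1" "(SUP t\<in>cball 0 1. ereal (g (\<gamma> t))) = ereal (g (\<gamma> t))"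
      "\<forall>s\<in>cball 0 1. g (\<gamma> s) \<le> g (\<gamma> t)"
    using minimax_curve_attains_sup[OF assms] by blast
  have "minimax_level \<Gamma>0 g \<le> (SUP t\<in>cball 0 1. ereal (g (\<gamma> t)))"
    unfolding minimax_level_def using assms(2) by (rule INF_lower)
  with t show ?thesis by auto
qed

text \<open>Any admissible curve attains its maximum on the compact ball, which excludes
  +\<infinity>; lying strictly above the boundary level excludes -\<infinity>.\<close>

lemma minimax_level_real:
  fixes \<Gamma>0 :: "('e::euclidean_space \<Rightarrow> 'x::topological_space) set"
  assumes "continuous_on UNIV g" "minimax_class \<Gamma>0 \<noteq> {}"
    and "boundary_level \<Gamma>0 g < minimax_level \<Gamma>0 g"
  shows "ereal (real_of_ereal (minimax_level \<Gamma>0 g)) = minimax_level \<Gamma>0 g"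
proof -
  obtain \<gamma> where "\<gamma> \<in> minimax_class \<Gamma>0" using assms(2) by blast
  then obtain t where "minimax_level \<Gamma>0 g \<le> ereal (g (\<gamma> t))"
    using minimax_level_le_attained[OF assms(1)] by blast
  then show ?thesis using assms(3) by (cases "minimax_level \<Gamma>0 g") auto
qed

lemma minimax_level_almost_attained:
  assumes "minimax_level \<Gamma>0 g = ereal c" "e > 0"
  shows "\<exists>\<gamma>\<in>minimax_class \<Gamma>0. \<forall>t\<in>cball 0 1. g (\<gamma> t) \<le> c + e"
proof -
  have "minimax_level \<Gamma>0 g < ereal (c + e)" using assms by simp
  then obtain \<gamma> where \<gamma>: "\<gamma> \<in> minimax_class \<Gamma>0" "(SUP t\<in>cball 0 1. ereal (g (\<gamma> t))) < ereal (c + e)"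
    unfolding minimax_level_def INF_less_iff by blast
  have "g (\<gamma> t) \<le> c + e" if "t \<in> cball 0 1" for t
  proof -
    have "ereal (g (\<gamma> t)) \<le> (SUP t\<in>cball 0 1. ereal (g (\<gamma> t)))" using that by (rule SUP_upper)
    also note \<gamma>(2)
    finally have "ereal (g (\<gamma> t)) < ereal (c + e)" .
    then show ?thesis by simp
  qed
  with \<gamma>(1) show ?thesis by blast
qed

section \<open>From almost symmetric curves to symmetric critical points\<close>

context symmetrization_framework
begin

text \<open>The points where the lifted curve \<open>w\<close> reaches the level b form a compact
  set that misses the sphere, so they avoid a shell near it. Polarization does not raise values, so
  high points of the new curve are among them and escape the shell in which the homotopy is still
  running.\<close>

lemma almost_symmetric_curve:
  fixes \<Gamma>0 :: "('e::euclidean_space \<Rightarrow> 'x) set" and f :: "real \<Rightarrow> 'x \<Rightarrow> real"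
  assumes \<gamma>: "\<gamma> \<in> minimax_class \<Gamma>0" and g: "continuous_on UNIV (f l)"
    and b: "boundary_level \<Gamma>0 (f l) < ereal b" and "\<epsilon> > 0"
    and lift: "\<And>\<gamma>. \<gamma> \<in> minimax_class \<Gamma>0 \<Longrightarrow> \<exists>\<gamma>'\<in>minimax_class \<Gamma>0. \<exists>H0\<in>HH.
      \<gamma>' ` cball 0 1 \<subseteq> S \<and> (\<lambda>\<tau>\<in>sphere 0 1. pol (\<gamma>' \<tau>) H0) \<in> \<Gamma>0 \<and>
      (\<forall>t\<in>cball 0 1. \<forall>l\<in>\<Lambda>. f l (\<gamma>' t) \<le> f l (\<gamma> t))"
    and pol_le: "\<And>l H u. l \<in> \<Lambda> \<Longrightarrow> H \<in> HH \<Longrightarrow> u \<in> S \<Longrightarrow> f l (pol u H) \<le> f l u" and "l \<in> \<Lambda>"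
  shows "\<exists>\<gamma>'\<in>minimax_class \<Gamma>0. (\<forall>t\<in>cball 0 1. \<forall>l\<in>\<Lambda>. f l (\<gamma>' t) \<le> f l (\<gamma> t)) \<and>
    (\<forall>t\<in>cball 0 1. b \<le> f l (\<gamma>' t) \<longrightarrow> norm (emb (\<gamma>' t) - emb (ext_star star \<Theta> (\<gamma>' t))) \<le> \<epsilon>)"
proof -
  obtain w H0 where w: "w \<in> minimax_class \<Gamma>0" "w ` cball 0 1 \<subseteq> S" and H0: "H0 \<in> HH"
    and pol_w: "(\<lambda>\<tau>\<in>sphere 0 1. pol (w \<tau>) H0) \<in> \<Gamma>0"
    and w_le: "\<And>t l. t \<in> cball 0 1 \<Longrightarrow> l \<in> \<Lambda> \<Longrightarrow> f l (w t) \<le> f l (\<gamma> t)"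
    using lift[OF \<gamma>] by blast
  have w_cont: "continuous_on (cball 0 1) w" using minimax_classD(1)[OF w(1)] .
  define K where "K = {t \<in> cball 0 1. b \<le> f l (w t)}"
  have "closed K"
    unfolding K_def using w_cont
    by (intro continuous_on_closed_Collect_le continuous_on_compose2[OF g] continuous_on_const) auto
  moreover have "K \<subseteq> cball 0 1" by (auto simp: K_def)
  ultimately have "compact K"
    using bounded_subset[OF bounded_cball] by (simp add: compact_eq_bounded_closed)
  have low: "f l (w t) < b" if "t \<in> sphere 0 1" for t
    using le_less_trans[OF le_boundary_level[OF w(1) that] b] by simp
  have "\<exists>\<delta>>0. \<forall>t\<in>K. norm t \<le> 1 - \<delta>"
  proof (cases "K = {}")
    case True
    then show ?thesis by (intro exI[of _ 1]) auto
  next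
    case False
    obtain t where t: "t \<in> K" "\<forall>s\<in>K. norm s \<le> norm t"
      using continuous_attains_sup[OF \<open>compact K\<close> False, of norm] by (auto intro: continuous_intros)
    have "norm t \<noteq> 1" using low[of t] t(1) by (auto simp: K_def)
    with t show ?thesis by (intro exI[of _ "1 - norm t"]) (auto simp: K_def)
  qed
  then obtain \<delta> where \<delta>: "\<delta> > 0" "\<And>t. t \<in> K \<Longrightarrow> norm t \<le> 1 - \<delta>" by blast
  \<comment> \<open>The comparison covers all parameters at once: the later argument bounds the
    curve for \<open>s h\<close> and measures its height for \<open>\<mu>\<close>.\<close>
  define R where "R u v \<longleftrightarrow> (\<forall>l\<in>\<Lambda>. f l v \<le> f l u)" for u v
  have "\<exists>w'. continuous_on (cball 0 1) w' \<and> w' ` cball 0 1 \<subseteq> S \<and>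
    (\<forall>t\<in>sphere 0 1. w' t = pol (w t) H0) \<and> (\<forall>t\<in>cball 0 1. R (w t) (w' t)) \<and>
    (\<forall>t. norm t \<le> 1 - \<delta> \<longrightarrow> norm (emb (w' t) - emb (star (w' t))) \<le> \<epsilon>)"
    by (intro almost_symmetric_curve_in_S[OF w_cont w(2) H0 \<open>\<epsilon> > 0\<close> \<delta>(1)])
      (auto simp: R_def intro: order_trans[OF pol_le])
  then obtain w' where w': "continuous_on (cball 0 1) w'" "w' ` cball 0 1 \<subseteq> S"
      "\<And>t. t \<in> sphere 0 1 \<Longrightarrow> w' t = pol (w t) H0" "\<And>t. t \<in> cball 0 1 \<Longrightarrow> R (w t) (w' t)"
      "\<And>t. norm t \<le> 1 - \<delta> \<Longrightarrow> norm (emb (w' t) - emb (star (w' t))) \<le> \<epsilon>"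
    by blast
  have "restrict w' (sphere 0 1) = (\<lambda>\<tau>\<in>sphere 0 1. pol (w \<tau>) H0)"
    using w'(3) by (intro restrict_ext) auto
  then have "restrict w' (cball 0 1) \<in> minimax_class \<Gamma>0"
    using pol_w w'(1) by (intro restrict_in_minimax_class) auto
  moreover have "f l (w' t) \<le> f l (\<gamma> t)" if "t \<in> cball 0 1" "l \<in> \<Lambda>" for t l
    using w'(4)[OF that(1)] w_le[OF that] that(2) by (force simp: R_def)
  moreover have "norm (emb (w' t) - emb (ext_star star \<Theta> (w' t))) \<le> \<epsilon>"
    if t: "t \<in> cball 0 1" "b \<le> f l (w' t)" for t
  proof -
    have "t \<in> K" using w'(4)[OF t(1)] t \<open>l \<in> \<Lambda>\<close> by (force simp: R_def K_def)
    moreover have "w' t \<in> S" using w'(2) t(1) by blast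
    ultimately show ?thesis using w'(5)[OF \<delta>(2)] by (simp add: ext_star_on_S)
  qed
  ultimately show ?thesis by (intro bexI[of _ "restrict w' (cball 0 1)"]) auto
qed

text \<open>Along the convergent subsequence the slope is handled by lower semicontinuity and the
  level by continuity of \<open>g\<close>. Symmetry passes to the limit only in V, and injectivity
  of \<open>emb\<close> brings it back to X.\<close>

lemma SBPS_condition_imp_critical_point:
  assumes "SBPS_condition emb (ext_star star \<Theta>) g c" "SBPS_seq emb (ext_star star \<Theta>) g c u"
    and g: "continuous_on UNIV g"
  shows "\<exists>x. g x = c \<and> weak_slope g x = 0 \<and> x = ext_star star \<Theta> x"
proof -
  let ?E = "ext_star star \<Theta>"
  obtain r x where r: "strict_mono r" and x: "(u \<circ> r) \<longlonglongrightarrow> x"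
    using assms(1,2) unfolding SBPS_condition_def convergent_def by blast
  have u: "(\<lambda>n. weak_slope g (u n)) \<longlonglongrightarrow> 0" "(\<lambda>n. g (u n)) \<longlonglongrightarrow> c"
      "(\<lambda>n. norm (emb (u n) - emb (?E (u n)))) \<longlonglongrightarrow> 0"
    using assms(2) by (auto simp: SBPS_seq_def)
  note sub = LIMSEQ_subseq_LIMSEQ[OF _ r]
  have "weak_slope g x = 0"
    using weak_slope_eq_0_limit[OF x, of g] sub[OF u(1)] by (simp add: o_def)
  moreover have "g x = c"
  proof (rule LIMSEQ_unique)
    show "(\<lambda>n. g ((u \<circ> r) n)) \<longlonglongrightarrow> g x"
      using continuous_on_tendsto_compose[OF g x] by simp
    show "(\<lambda>n. g ((u \<circ> r) n)) \<longlonglongrightarrow> c" using sub[OF u(2)] by (simp add: o_def)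
  qed
  moreover have "x = ?E x"
  proof -
    obtain L where L: "\<And>u v. norm (emb (?E u) - emb (?E v)) \<le> L * norm (emb u - emb v)"
      using ext_star_lipschitz by blast
    have emb_x: "(\<lambda>n. emb ((u \<circ> r) n)) \<longlonglongrightarrow> emb x"
      by (rule bounded_linear.tendsto[OF emb_bounded_linear x])
    have "(\<lambda>n. L * norm (emb ((u \<circ> r) n) - emb x)) \<longlonglongrightarrow> L * norm (emb x - emb x)"
      by (intro tendsto_intros emb_x)
    then have "(\<lambda>n. L * norm (emb ((u \<circ> r) n) - emb x)) \<longlonglongrightarrow> 0" by simp
    then have "(\<lambda>n. emb (?E ((u \<circ> r) n)) - emb (?E x)) \<longlonglongrightarrow> 0"
      by (rule Lim_null_comparison[rotated]) (intro always_eventually allI L)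
    then have "(\<lambda>n. emb (?E ((u \<circ> r) n))) \<longlonglongrightarrow> emb (?E x)"
      by (rule LIM_zero_cancel)
    with emb_x have "(\<lambda>n. norm (emb ((u \<circ> r) n) - emb (?E ((u \<circ> r) n)))) \<longlonglongrightarrow> norm (emb x - emb (?E x))"
      by (intro tendsto_intros)
    moreover have "(\<lambda>n. norm (emb ((u \<circ> r) n) - emb (?E ((u \<circ> r) n)))) \<longlonglongrightarrow> 0"
      using sub[OF u(3)] by (simp add: o_def)
    ultimately have "norm (emb x - emb (?E x)) = 0" by (rule LIMSEQ_unique)
    then show ?thesis using emb_inj by (simp add: inj_eq)
  qed
  ultimately show ?thesis by blast
qed

lemma critical_point_at_non_steep_parameter:
  fixes \<Gamma>0 :: "('e::euclidean_space \<Rightarrow> 'x) set" and f :: "real \<Rightarrow> 'x \<Rightarrow> real" and C :: "real \<Rightarrow> real"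
  assumes f_cont: "\<And>l. l \<in> \<Lambda> \<Longrightarrow> continuous_on UNIV (f l)"
    and gap: "\<And>l. l \<in> \<Lambda> \<Longrightarrow> boundary_level \<Gamma>0 (f l) < minimax_level \<Gamma>0 (f l)"
    and level: "\<And>l. l \<in> \<Lambda> \<Longrightarrow> minimax_level \<Gamma>0 (f l) = ereal (C l)"
    and M: "\<And>B (ls :: nat \<Rightarrow> real) (us :: nat \<Rightarrow> 'x) l.
      range ls \<subseteq> \<Lambda> \<Longrightarrow> strict_mono ls \<Longrightarrow> ls \<longlonglongrightarrow> l \<Longrightarrow>
      (\<And>h. f (ls h) (us h) \<le> B \<and> - f l (us h) \<le> B \<and> (f (ls h) (us h) - f l (us h)) / (l - ls h) \<le> B) \<Longrightarrow>
      (\<forall>h. norm (us h) \<le> M B) \<and> (\<forall>\<epsilon>>0. \<forall>\<^sub>F h in sequentially. f l (us h) \<le> f (ls h) (us h) + \<epsilon>)"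
    and lift: "\<And>\<gamma>. \<gamma> \<in> minimax_class \<Gamma>0 \<Longrightarrow> \<exists>\<gamma>'\<in>minimax_class \<Gamma>0. \<exists>H0\<in>HH.
      \<gamma>' ` cball 0 1 \<subseteq> S \<and> (\<lambda>\<tau>\<in>sphere 0 1. pol (\<gamma>' \<tau>) H0) \<in> \<Gamma>0 \<and>
      (\<forall>t\<in>cball 0 1. \<forall>l\<in>\<Lambda>. f l (\<gamma>' t) \<le> f l (\<gamma> t))"
    and pol_le: "\<And>l H u. l \<in> \<Lambda> \<Longrightarrow> H \<in> HH \<Longrightarrow> u \<in> S \<Longrightarrow> f l (pol u H) \<le> f l u"
    and SBPS: "SBPS_condition emb (ext_star star \<Theta>) (f \<mu>) (C \<mu>)"
    and s: "strict_mono s" "s \<longlonglongrightarrow> \<mu>" "range s \<subseteq> \<Lambda>" "\<mu> \<in> \<Lambda>"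
    and s_less: "\<And>h. s h < \<mu>" and C0: "\<And>h. C (s h) - C \<mu> \<le> C0 * (\<mu> - s h)"
  shows "\<exists>u. f \<mu> u = C \<mu> \<and> weak_slope (f \<mu>) u = 0 \<and> u = ext_star star \<Theta> u"
proof -
  let ?E = "ext_star star \<Theta>"
  let ?d = "\<lambda>h. \<mu> - s h"
  have s_in: "s h \<in> \<Lambda>" for h using s(3) by blast
  have d_pos: "?d h > 0" for h using s_less by simp
  have d_le: "?d h \<le> ?d 0" for h using s(1) by (simp add: strict_mono_less_eq)
  \<comment> \<open>The curves are made almost symmetric above b, which lies strictly below the
    minimax level and so leaves a margin for high points.\<close>
  obtain b where b: "boundary_level \<Gamma>0 (f \<mu>) < ereal b" "b < C \<mu>"
    using ereal_dense2[OF gap[OF s(4)]] level[OF s(4)] by auto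
  have "\<exists>\<gamma>\<in>minimax_class \<Gamma>0. (\<forall>t\<in>cball 0 1. f (s h) (\<gamma> t) \<le> C (s h) + ?d h) \<and>
      (\<forall>t\<in>cball 0 1. b \<le> f \<mu> (\<gamma> t) \<longrightarrow> norm (emb (\<gamma> t) - emb (?E (\<gamma> t))) \<le> inverse (real (Suc h)))" for h
  proof -
    obtain \<gamma> where \<gamma>: "\<gamma> \<in> minimax_class \<Gamma>0" "\<And>t. t \<in> cball 0 1 \<Longrightarrow> f (s h) (\<gamma> t) \<le> C (s h) + ?d h"
      using minimax_level_almost_attained[OF level[OF s_in] d_pos] by blast
    have "inverse (real (Suc h)) > 0" by simp
    from almost_symmetric_curve[OF \<gamma>(1) f_cont[OF s(4)] b(1) this lift pol_le s(4)]
    obtain \<gamma>' where "\<gamma>' \<in> minimax_class \<Gamma>0" "\<And>t l. t \<in> cball 0 1 \<Longrightarrow> l \<in> \<Lambda> \<Longrightarrow> f l (\<gamma>' t) \<le> f l (\<gamma> t)"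
      "\<And>t. t \<in> cball 0 1 \<Longrightarrow> b \<le> f \<mu> (\<gamma>' t) \<Longrightarrow> norm (emb (\<gamma>' t) - emb (?E (\<gamma>' t))) \<le> inverse (real (Suc h))"
      by auto
    with \<gamma>(2) s_in[of h] show ?thesis by (meson order_trans)
  qed
  then obtain \<gamma> where \<gamma>: "\<And>h. \<gamma> h \<in> minimax_class \<Gamma>0"
    and \<gamma>_top: "\<And>h t. t \<in> cball 0 1 \<Longrightarrow> f (s h) (\<gamma> h t) \<le> C (s h) + ?d h"
    and \<gamma>_sym: "\<And>h t. t \<in> cball 0 1 \<Longrightarrow> b \<le> f \<mu> (\<gamma> h t) \<Longrightarrow>
      norm (emb (\<gamma> h t) - emb (?E (\<gamma> h t))) \<le> inverse (real (Suc h))"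
    by metis
  have \<gamma>_top': "f (s h) (\<gamma> h t) \<le> C \<mu> + (\<bar>C0\<bar> + 1) * ?d h" if "t \<in> cball 0 1" for h t
  proof -
    have "C0 * ?d h \<le> \<bar>C0\<bar> * ?d h" using d_pos[of h] by (intro mult_right_mono) auto
    then show ?thesis using \<gamma>_top[OF that, of h] C0[of h] by (simp add: algebra_simps)
  qed
  \<comment> \<open>The three entries bound the three quantities in (ii). In C0 + 2, one unit comes
    from the slack of the curve at \<open>s h\<close> and one from the threshold in
    \<open>high\<close>.\<close>
  define B where "B = Max {C \<mu> + (\<bar>C0\<bar> + 1) * ?d 0, - C \<mu> + ?d 0, C0 + 2}"
  define high where "high h u \<longleftrightarrow> (\<exists>t\<in>cball 0 1. u = \<gamma> h t \<and> C \<mu> - ?d h \<le> f \<mu> (\<gamma> h t))" for h u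
  have bound: "f (s h) u \<le> B \<and> - f \<mu> u \<le> B \<and> (f (s h) u - f \<mu> u) / (\<mu> - s h) \<le> B" if "high h u" for h u
  proof -
    obtain t where t: "t \<in> cball 0 1" "u = \<gamma> h t" "C \<mu> - ?d h \<le> f \<mu> u"
      using \<open>high h u\<close> by (auto simp: high_def)
    have "(\<bar>C0\<bar> + 1) * ?d h \<le> (\<bar>C0\<bar> + 1) * ?d 0"
      using d_le by (intro mult_left_mono) auto
    then have "f (s h) u \<le> C \<mu> + (\<bar>C0\<bar> + 1) * ?d 0"
      using \<gamma>_top'[OF t(1), of h] t(2) by simp
    moreover have "- f \<mu> u \<le> - C \<mu> + ?d 0" using t(3) d_le[of h] by simp
    moreover have "f (s h) u - f \<mu> u \<le> (C0 + 2) * ?d h"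
      using \<gamma>_top[OF t(1), of h] C0[of h] t(2,3) by (simp add: algebra_simps)
    then have "(f (s h) u - f \<mu> u) / ?d h \<le> C0 + 2"
      using d_pos[of h] by (simp add: pos_divide_le_eq)
    ultimately show ?thesis unfolding B_def by (auto simp: le_max_iff_disj)
  qed
  have "\<exists>t\<in>cball 0 1. C \<mu> \<le> f \<mu> (\<gamma> h t) \<and> (\<forall>r\<in>cball 0 1. f \<mu> (\<gamma> h r) \<le> f \<mu> (\<gamma> h t))" for h
    using minimax_level_le_attained[OF f_cont[OF s(4)] \<gamma>, of h] level[OF s(4)] by simp
  then obtain p where p: "\<And>h. p h \<in> cball 0 1" "\<And>h. C \<mu> \<le> f \<mu> (\<gamma> h (p h))"
      "\<And>h r. r \<in> cball 0 1 \<Longrightarrow> f \<mu> (\<gamma> h r) \<le> f \<mu> (\<gamma> h (p h))"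
    by metis
  have p_high: "high h (\<gamma> h (p h))" for h
    unfolding high_def by (intro bexI[OF _ p(1)]) (use p(2)[of h] d_pos[of h] in auto)
  have high_bdd: "norm u \<le> M B" if "high h u" for h u
  proof -
    \<comment> \<open>Assumption (ii) speaks of sequences. A single high point is placed at index h
      and maximizers fill the other indices, which bounds all high points by the same
      \<open>M B\<close>.\<close>
    define us where "us k = (if k = h then u else \<gamma> k (p k))" for k
    have "high k (us k)" for k using that p_high by (simp add: us_def)
    then have "norm (us h) \<le> M B" using M[OF s(3,1,2), of us B] bound by blast
    then show ?thesis by (simp add: us_def)
  qed
  \<comment> \<open>The second half of (ii) is applied only at the maximizers \<open>p h\<close>,
    and this already controls the whole curve uniformly.\<close>
  have upper: "\<forall>\<^sub>F h in sequentially. \<forall>t\<in>cball 0 1. f \<mu> (\<gamma> h t) \<le> C \<mu> + e" if "e > 0" for e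
  proof -
    have "\<forall>\<^sub>F h in sequentially. f \<mu> (\<gamma> h (p h)) \<le> f (s h) (\<gamma> h (p h)) + e / 2"
      using M[OF s(3,1,2), of "\<lambda>h. \<gamma> h (p h)" B] bound[OF p_high] \<open>e > 0\<close> by simp
    moreover have "(\<lambda>h. (\<bar>C0\<bar> + 1) * ?d h) \<longlonglongrightarrow> (\<bar>C0\<bar> + 1) * (\<mu> - \<mu>)"
      by (intro tendsto_intros s(2))
    then have "\<forall>\<^sub>F h in sequentially. (\<bar>C0\<bar> + 1) * ?d h < e / 2"
      by (rule order_tendstoD(2)) (use \<open>e > 0\<close> in simp)
    ultimately show ?thesis
    proof eventually_elim
      case (elim h)
      have "f \<mu> (\<gamma> h (p h)) \<le> C \<mu> + e"
        using \<gamma>_top'[OF p(1)[of h], of h] elim by linarith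
      then show ?case using order_trans[OF p(3)] by blast
    qed
  qed
  obtain A where A: "A > 0" "\<And>x. norm (emb x) \<le> norm x * A"
    using bounded_linear.pos_bounded[OF emb_bounded_linear] by blast
  obtain L where L: "L \<ge> 0" "\<And>u v. norm (emb (?E u) - emb (?E v)) \<le> L * norm (emb u - emb v)"
    using ext_star_lipschitz by blast
  \<comment> \<open>The constant collects three errors: A * k from moving in V, k from the asymmetry
    of the curve point, and L * A * k from moving its symmetrization.\<close>
  have almost: "\<exists>u. norm u \<le> M B + k \<and> C \<mu> \<le> f \<mu> u \<and> f \<mu> u \<le> C \<mu> + k\<^sup>2 \<and>
      weak_slope (f \<mu>) u \<le> ennreal (2 * k) \<and> norm (emb u - emb (?E u)) \<le> (A + 1 + L * A) * k" if k: "k > 0" for k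
  proof -
    have "\<forall>\<^sub>F h in sequentially. inverse (real (Suc h)) < k"
      using LIMSEQ_inverse_real_of_nat k by (rule order_tendstoD(2))
    moreover have "\<forall>\<^sub>F h in sequentially. \<forall>t\<in>cball 0 1. f \<mu> (\<gamma> h t) \<le> C \<mu> + k\<^sup>2"
      using k by (intro upper) simp
    ultimately have "\<forall>\<^sub>F h in sequentially. inverse (real (Suc h)) < k \<and> (\<forall>t\<in>cball 0 1. f \<mu> (\<gamma> h t) \<le> C \<mu> + k\<^sup>2)"
      by (rule eventually_conj)
    then obtain h where h: "inverse (real (Suc h)) < k" "\<And>t. t \<in> cball 0 1 \<Longrightarrow> f \<mu> (\<gamma> h t) \<le> C \<mu> + k\<^sup>2"
      using eventually_happens'[OF sequentially_bot] by blast
    \<comment> \<open>Above b the curve point is almost symmetric, and above the second term it is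
      \<open>high\<close>, hence bounded.\<close>
    define b' where "b' = max b (C \<mu> - ?d h)"
    have "\<exists>t\<in>cball 0 1. \<exists>u. b' < f \<mu> (\<gamma> h t) \<and> dist (\<gamma> h t) u \<le> k \<and> C \<mu> \<le> f \<mu> u \<and> f \<mu> u \<le> C \<mu> + k\<^sup>2 \<and>
        weak_slope (f \<mu>) u \<le> ennreal (2 * k)"
    proof (rule minimax_almost_critical_point[OF f_cont[OF s(4)] minimax_classD(1)[OF \<gamma>] _ _ _ h(2) k])
      show "f \<mu> (\<gamma> h t) \<le> b'" if "t \<in> sphere 0 1" for t
        using le_less_trans[OF le_boundary_level[OF \<gamma>[of h] that, of "f \<mu>"] b(1)] by (simp add: b'_def le_max_iff_disj)
      show "b' < C \<mu>" using b(2) d_pos[of h] by (simp add: b'_def)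
      show "\<exists>t\<in>cball 0 1. C \<mu> \<le> f \<mu> (\<eta> t)"
        if \<eta>: "continuous_on (cball 0 1) \<eta>" "\<And>t. t \<in> sphere 0 1 \<Longrightarrow> \<eta> t = \<gamma> h t" for \<eta>
      proof -
        have "restrict \<eta> (sphere 0 1) = restrict (\<gamma> h) (sphere 0 1)"
          using \<eta>(2) by (intro restrict_ext)
        then have "restrict \<eta> (cball 0 1) \<in> minimax_class \<Gamma>0"
          using \<eta>(1) minimax_classD(2)[OF \<gamma>, of h] by (intro restrict_in_minimax_class) auto
        from minimax_level_le_attained[OF f_cont[OF s(4)] this] show ?thesis
          using level[OF s(4)] by auto
      qed
    qed
    then obtain t u where t: "t \<in> cball 0 1" "b' < f \<mu> (\<gamma> h t)" and tu: "dist (\<gamma> h t) u \<le> k"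
      and u: "C \<mu> \<le> f \<mu> u" "f \<mu> u \<le> C \<mu> + k\<^sup>2" "weak_slope (f \<mu>) u \<le> ennreal (2 * k)"
      by blast
    let ?v = "\<gamma> h t"
    have "norm ?v \<le> M B" using t by (intro high_bdd[of h]) (auto simp: high_def b'_def)
    then have "norm u \<le> M B + k"
      using tu norm_triangle_ineq2[of u ?v] by (simp add: dist_norm norm_minus_commute)
    moreover have "norm (emb u - emb (?E u)) \<le> (A + 1 + L * A) * k"
    proof -
      have "norm (emb u - emb ?v) \<le> norm (u - ?v) * A" using A(2)[of "u - ?v"] by (simp add: emb_diff)
      also have "\<dots> \<le> k * A" using tu A(1) by (intro mult_right_mono) (auto simp: dist_norm norm_minus_commute)
      finally have uv: "norm (emb u - emb ?v) \<le> k * A" .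
      have "L * norm (emb ?v - emb u) \<le> L * (k * A)"
        using uv L(1) by (intro mult_left_mono) (auto simp: norm_minus_commute)
      then have Euv: "norm (emb (?E ?v) - emb (?E u)) \<le> L * (k * A)" using L(2)[of ?v u] by linarith
      have "norm (emb ?v - emb (?E ?v)) \<le> k" using \<gamma>_sym[OF t(1), of h] t(2) h(1) by (simp add: b'_def)
      then have "norm (emb u - emb (?E u)) \<le> k * A + k + L * (k * A)"
        using uv Euv norm_triangle_ineq[of "emb u - emb ?v" "emb ?v - emb (?E ?v)"]
          norm_triangle_ineq[of "emb u - emb (?E ?v)" "emb (?E ?v) - emb (?E u)"]
        by simp
      then show ?thesis by (simp add: algebra_simps)
    qed
    ultimately show ?thesis using u by blast
  qed
  define k where "k n = inverse (real (Suc n))" for n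
  have k: "k n > 0" "k n \<le> 1" "k \<longlonglongrightarrow> 0" for n
    using LIMSEQ_inverse_real_of_nat by (auto simp: k_def[abs_def] inverse_le_1_iff)
  have "\<forall>n. \<exists>u. norm u \<le> M B + k n \<and> C \<mu> \<le> f \<mu> u \<and> f \<mu> u \<le> C \<mu> + (k n)\<^sup>2 \<and>
      weak_slope (f \<mu>) u \<le> ennreal (2 * k n) \<and> norm (emb u - emb (?E u)) \<le> (A + 1 + L * A) * k n"
    using almost k(1) by blast
  then obtain u where u: "\<And>n. norm (u n) \<le> M B + k n" "\<And>n. C \<mu> \<le> f \<mu> (u n)"
      "\<And>n. f \<mu> (u n) \<le> C \<mu> + (k n)\<^sup>2" "\<And>n. weak_slope (f \<mu>) (u n) \<le> ennreal (2 * k n)"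
      "\<And>n. norm (emb (u n) - emb (?E (u n))) \<le> (A + 1 + L * A) * k n"
    by metis
  have "SBPS_seq emb ?E (f \<mu>) (C \<mu>) u"
    unfolding SBPS_seq_def
  proof (intro conjI)
    show "bounded (range u)"
      using order_trans[OF u(1) add_left_mono[OF k(2)]] by (intro boundedI[of _ "M B + 1"]) auto
    have "(\<lambda>n. ennreal (2 * k n)) \<longlonglongrightarrow> ennreal (2 * 0)"
      by (intro tendsto_ennrealI tendsto_intros k(3))
    then have slope_lim: "(\<lambda>n. ennreal (2 * k n)) \<longlonglongrightarrow> 0" by simp
    show "(\<lambda>n. weak_slope (f \<mu>) (u n)) \<longlonglongrightarrow> 0"
      by (rule tendsto_sandwich[OF _ _ tendsto_const slope_lim]) (use u(4) in auto)
    have "(\<lambda>n. C \<mu> + (k n)\<^sup>2) \<longlonglongrightarrow> C \<mu> + 0\<^sup>2"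
      by (intro tendsto_intros k(3))
    then have level_lim: "(\<lambda>n. C \<mu> + (k n)\<^sup>2) \<longlonglongrightarrow> C \<mu>" by simp
    show "(\<lambda>n. f \<mu> (u n)) \<longlonglongrightarrow> C \<mu>"
      by (rule tendsto_sandwich[OF _ _ tendsto_const level_lim]) (use u(2,3) in auto)
    have "(\<lambda>n. (A + 1 + L * A) * k n) \<longlonglongrightarrow> (A + 1 + L * A) * 0"
      by (intro tendsto_intros k(3))
    then have sym_lim: "(\<lambda>n. (A + 1 + L * A) * k n) \<longlonglongrightarrow> 0" by simp
    show "(\<lambda>n. norm (emb (u n) - emb (?E (u n)))) \<longlonglongrightarrow> 0"
      by (rule tendsto_sandwich[OF _ _ tendsto_const sym_lim]) (use u(5) in auto)
  qed
  then show ?thesis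
    using SBPS_condition_imp_critical_point[OF SBPS _ f_cont[OF s(4)]] by blast
qed

end

section \<open>Accumulation of critical parameters at 1\<close>

theorem corollary3p3:
  fixes emb :: "'x::banach \<Rightarrow> 'v::banach"
    and S :: "'x set"
    and HH :: "'h::topological_space set"
    and star :: "'x \<Rightarrow> 'x"
    and pol :: "'x \<Rightarrow> 'h \<Rightarrow> 'x"
    and \<Theta> :: "'x \<Rightarrow> 'x"
    and \<sigma> :: real
    and \<Lambda> :: "real set"
    and f :: "real \<Rightarrow> 'x \<Rightarrow> real"
    and \<Gamma>0 :: "(real ^ 'm::finite \<Rightarrow> 'x) set"
    and \<Gamma> :: "(real ^ 'm \<Rightarrow> 'x) set"
    and a c :: "real \<Rightarrow> ereal"
  defines "\<Gamma> \<equiv> minimax_class \<Gamma>0"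
    and "c \<equiv> \<lambda>l. minimax_level \<Gamma>0 (f l)"
    and "a \<equiv> \<lambda>l. boundary_level \<Gamma>0 (f l)"
  assumes framework: "symmetrization_framework emb S HH star pol \<Theta>"
    and sigma_pos: "\<sigma> > 0"
    and Lambda: "compact \<Lambda>" "is_interval \<Lambda>" "{1 - \<sigma>..1} \<subseteq> \<Lambda>"
    and f_cont: "\<And>l. l \<in> \<Lambda> \<Longrightarrow> continuous_on UNIV (f l)"
    and Gamma0: "\<Gamma>0 \<subseteq> cont_maps (sphere 0 1)"
    and Gamma_nonempty: "\<Gamma> \<noteq> {}"
    and i: "\<And>l. l \<in> \<Lambda> \<Longrightarrow> c l > a l"
    and ii: "\<exists>M :: real \<Rightarrow> real. \<forall>C. M C \<ge> 0 \<and>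
      (\<forall>(ls :: nat \<Rightarrow> real) (us :: nat \<Rightarrow> 'x) l.
         range ls \<subseteq> \<Lambda> \<and> strict_mono ls \<and> ls \<longlonglongrightarrow> l \<and>
         (\<forall>h. f (ls h) (us h) \<le> C \<and> - f l (us h) \<le> C \<and>
              (f (ls h) (us h) - f l (us h)) / (l - ls h) \<le> C) \<longrightarrow>
         (\<forall>h. norm (us h) \<le> M C) \<and>
         (\<forall>\<epsilon>>0. \<forall>\<^sub>F h in sequentially. f l (us h) \<le> f (ls h) (us h) + \<epsilon>))"
    and iii_lift: "\<And>\<gamma>. \<gamma> \<in> \<Gamma> \<Longrightarrow> \<exists>\<gamma>'\<in>\<Gamma>. \<exists>H0\<in>HH.
      \<gamma>' ` cball 0 1 \<subseteq> S \<and>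
      (\<lambda>\<tau>\<in>sphere 0 1. pol (\<gamma>' \<tau>) H0) \<in> \<Gamma>0 \<and>
      (\<forall>t\<in>cball 0 1. \<forall>l\<in>\<Lambda>. f l (\<gamma>' t) \<le> f l (\<gamma> t))"
    and iii_pol: "\<And>l H u. l \<in> \<Lambda> \<Longrightarrow> H \<in> HH \<Longrightarrow> u \<in> S \<Longrightarrow> f l (pol u H) \<le> f l u"
    and iv: "\<And>l. l \<in> {1 - \<sigma>..1} \<Longrightarrow>
      SBPS_condition emb (ext_star star \<Theta>) (f l) (real_of_ereal (c l))"
  shows "\<exists>(ls :: nat \<Rightarrow> real) (us :: nat \<Rightarrow> 'x).
    range ls \<subseteq> {1 - \<sigma>..1} \<and> strict_mono ls \<and> ls \<longlonglongrightarrow> 1 \<and>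
    (\<forall>j. ereal (f (ls j) (us j)) = c (ls j) \<and>
         weak_slope (f (ls j)) (us j) = 0 \<and>
         us j = ext_star star \<Theta> (us j))"
proof -
  interpret symmetrization_framework emb S HH star pol \<Theta> by (rule framework)
  define C where "C l = real_of_ereal (c l)" for l
  have level: "c l = ereal (C l)" if "l \<in> \<Lambda>" for l
    using minimax_level_real[OF f_cont[OF that], of \<Gamma>0, symmetric] Gamma_nonempty i[OF that]
    by (simp add: C_def \<Gamma>_def c_def a_def)
  obtain M where M_all: "\<forall>C. M C \<ge> 0 \<and>
      (\<forall>(ls :: nat \<Rightarrow> real) (us :: nat \<Rightarrow> 'x) l.
         range ls \<subseteq> \<Lambda> \<and> strict_mono ls \<and> ls \<longlonglongrightarrow> l \<and>
         (\<forall>h. f (ls h) (us h) \<le> C \<and> - f l (us h) \<le> C \<and>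
              (f (ls h) (us h) - f l (us h)) / (l - ls h) \<le> C) \<longrightarrow>
         (\<forall>h. norm (us h) \<le> M C) \<and>
         (\<forall>\<epsilon>>0. \<forall>\<^sub>F h in sequentially. f l (us h) \<le> f (ls h) (us h) + \<epsilon>))"
    using ii ..
  have M: "(\<forall>h. norm (us h) \<le> M B) \<and>
      (\<forall>\<epsilon>>0. \<forall>\<^sub>F h in sequentially. f l (us h) \<le> f (ls h) (us h) + \<epsilon>)"
    if "range ls \<subseteq> \<Lambda>" "strict_mono ls" "ls \<longlonglongrightarrow> l"
      "\<And>h. f (ls h) (us h) \<le> B \<and> - f l (us h) \<le> B \<and> (f (ls h) (us h) - f l (us h)) / (l - ls h) \<le> B"
    for B l and ls :: "nat \<Rightarrow> real" and us :: "nat \<Rightarrow> 'x"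
    using M_all[THEN spec[of _ B], THEN conjunct2, THEN spec[of _ ls], THEN spec[of _ us], THEN spec[of _ l]]
      that by blast
  define critical where "critical l \<longleftrightarrow> l \<in> {1 - \<sigma>..1} \<and> (\<exists>u. ereal (f l u) = c l \<and>
      weak_slope (f l) u = 0 \<and> u = ext_star star \<Theta> u)" for l
  have "\<exists>l. d < l \<and> l < 1 \<and> critical l" if "d < 1" for d
  proof -
    define \<alpha> where "\<alpha> = max d (1 - \<sigma>)"
    have "\<alpha> < 1" using that sigma_pos by (simp add: \<alpha>_def)
    then obtain l C0 where "l \<in> {\<alpha><..<1}"
      and C0: "\<forall>d<l. \<exists>s. d < s \<and> s < l \<and> C s - C l \<le> C0 * (l - s)"
      using exists_non_steep_point[of \<alpha> 1 C] by blast
    then have l: "\<alpha> < l" "l < 1" by auto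
    \<comment> \<open>Points s below \<open>\<alpha>\<close> may lie outside
      \<open>\<Lambda>\<close>, where \<open>C\<close> carries no information, so the approximating
      parameters are kept above \<open>\<alpha>\<close>.\<close>
    have "\<exists>s. d < s \<and> s < l \<and> \<alpha> < s \<and> C s - C l \<le> C0 * (l - s)" if "d < l" for d
      using C0[THEN spec[of _ "max d \<alpha>"]] that l by auto
    from exists_strict_mono_to_left[OF this] obtain s :: "nat \<Rightarrow> real" where
      s: "strict_mono s" "s \<longlonglongrightarrow> l" "\<And>n. s n < l" "\<And>n. \<alpha> < s n" "\<And>n. C (s n) - C l \<le> C0 * (l - s n)"
      by blast
    have in_Lambda: "r \<in> \<Lambda>" if "\<alpha> < r" "r \<le> l" for r
      using that l Lambda(3) by (auto simp: \<alpha>_def subset_iff)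
    have range: "range s \<subseteq> \<Lambda>" using in_Lambda s(3,4) by (auto intro: less_imp_le)
    have l_in: "l \<in> \<Lambda>" "l \<in> {1 - \<sigma>..1}" using in_Lambda l by (auto simp: \<alpha>_def)
    have "\<exists>u. f l u = C l \<and> weak_slope (f l) u = 0 \<and> u = ext_star star \<Theta> u"
    proof (rule critical_point_at_non_steep_parameter[OF f_cont _ _ M _ _ _ s(1,2) range l_in(1) s(3,5)])
      show "boundary_level \<Gamma>0 (f r) < minimax_level \<Gamma>0 (f r)" if "r \<in> \<Lambda>" for r
        using i[OF that] by (simp add: a_def c_def)
      show "minimax_level \<Gamma>0 (f r) = ereal (C r)" if "r \<in> \<Lambda>" for r
        using level[OF that] by (simp add: c_def)
      show "SBPS_condition emb (ext_star star \<Theta>) (f l) (C l)"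
        using iv[OF l_in(2)] by (simp add: C_def)
    qed (use iii_lift iii_pol in \<open>simp_all add: \<Gamma>_def\<close>)
    then have "critical l" using l_in level by (auto simp: critical_def)
    with l show ?thesis by (auto simp: \<alpha>_def)
  qed
  from exists_strict_mono_to_left[OF this] obtain ls :: "nat \<Rightarrow> real" where
    ls: "strict_mono ls" "ls \<longlonglongrightarrow> 1" "\<And>n. critical (ls n)"
    by blast
  then obtain us where "\<And>n. ereal (f (ls n) (us n)) = c (ls n) \<and>
      weak_slope (f (ls n)) (us n) = 0 \<and> us n = ext_star star \<Theta> (us n)"
    unfolding critical_def by metis
  moreover have "range ls \<subseteq> {1 - \<sigma>..1}" using ls(3) by (auto simp: critical_def)
  ultimately show ?thesis using ls(1,2) by blast
qed

end
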